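(* Let $d\ge2$ and $\gamma>\frac12$. There exists a positive constant $C_{d,\gamma}$, depending only on $d$ and $\gamma$, such that for every $N\ge2$ and every $N$-point cubature rule $Q[X_N,\omega]$ on $\mathbb{S}^d$ (with real weights satisfying $\sum_{i=1}^N\omega_i=1$), $$\mathrm{wce}\big(Q[X_N,\omega];\mathbb{H}^{(\frac d2,\gamma)}(\mathbb{S}^d)\big)\ \ge\ C_{d,\gamma}\,N^{-\frac12}(\ln N)^{-\gamma}.$$
   Context: $\mathbb{S}^d\subset\mathbb{R}^{d+1}$ is the unit sphere, $\sigma_d$ its normalised surface measure ($\sigma_d(\mathbb{S}^d)=1$), $\mathrm{I}(f)=\int_{\mathbb{S}^d}f\,d\sigma_d$. For $X_N=\{\mathbf{x}_1,\dots,\mathbf{x}_N\}\subset\mathbb{S}^d$ and weights $\omega=(\omega_j)_{j=1}^N\in\mathbb{R}^N$, the $N$-point cubature rule is $Q[X_N,\omega](f)=\sum_{i=1}^N\omega_if(\mathbf{x}_i)$. For a Banach space $B$ of continuous functions on $\mathbb{S}^d$, $\mathrm{wce}(Q;B)=\sup_{f\in B,\ \|f\|_B\le1}|Q(f)-\mathrm{I}(f)|$. Let $\{Y^{(d)}_{\ell,k}:k=1,\dots,Z(d,\ell)\}$ be an $L_2(\mathbb{S}^d,\sigma_d)$-orthonormal basis of the real spherical harmonics of degree $\ell$ ($Z(d,\ell)$ is the dimension of that space), $\hat f_{\ell,k}=\int_{\mathbb{S}^d}fY^{(d)}_{\ell,k}\,d\sigma_d$, and $\lambda_\ell=\ell(\ell+d-1)$.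 For $\gamma>\frac12$, $\mathbb{H}^{(\frac d2,\gamma)}(\mathbb{S}^d)$ is the space of all $f\in L_2(\mathbb{S}^d)$ with $$\|f\|^2_{\mathbb{H}^{(\frac d2,\gamma)}}=\sum_{\ell=0}^\infty w_\ell(d,\gamma)\sum_{k=1}^{Z(d,\ell)}|\hat f_{\ell,k}|^2<\infty,\qquad w_\ell(d,\gamma)=(1+\lambda_\ell)^{\frac d2}\big(\ln(3+\lambda_\ell)\big)^{2\gamma}.$$ It embeds into $C(\mathbb{S}^d)$ (functions are identified with their continuous representatives). *)

theory Defs
  imports "HOL-Analysis.Analysis" "HOL-Probability.Probability"
begin

text \<open>
  The normalised surface measure of the unit sphere, as the normalised cone measure: the measure
  of \<open>A\<close> is the proportion of the unit ball filled by the radial segments ending in \<open>A\<close>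
  (the sphere itself gets mass 1; the junk value of the radial projection at the origin
  is a null set).
\<close>

definition sphere_measure :: "'a::euclidean_space measure" where
  "sphere_measure =
     restrict_space (distr (uniform_measure lborel (ball 0 1)) borel (\<lambda>x. x /\<^sub>R norm x)) (sphere 0 1)"

lemma space_sphere_measure [simp]: "space (sphere_measure :: 'a::euclidean_space measure) = sphere 0 1"
  by (simp add: sphere_measure_def space_restrict_space)

lemma sets_sphere_measure [measurable_cong]:
  "sets (sphere_measure :: 'a::euclidean_space measure) = sets (restrict_space borel (sphere 0 1))"
  unfolding sphere_measure_def by (intro sets_restrict_space_cong) simp

lemma emeasure_sphere_measure:
  fixes A :: "'a::euclidean_space set"
  assumes "A \<in> sets borel" "A \<subseteq> sphere 0 1"
  shows "emeasure sphere_measure A =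
    emeasure lborel {x. norm x < 1 \<and> x /\<^sub>R norm x \<in> A} / emeasure lborel (ball (0::'a) 1)"
proof -
  have m: "(\<lambda>x::'a. x /\<^sub>R norm x) \<in> borel_measurable borel" by measurable
  have v: "(\<lambda>x. x /\<^sub>R norm x) -` A \<in> sets borel"
    using measurable_sets[OF m assms(1)] by simp
  have "emeasure sphere_measure A =
      emeasure (distr (uniform_measure lborel (ball 0 1)) borel (\<lambda>x::'a. x /\<^sub>R norm x)) A"
    unfolding sphere_measure_def using assms(2) by (subst emeasure_restrict_space) auto
  also have "\<dots> = emeasure (uniform_measure lborel (ball 0 1)) ((\<lambda>x::'a. x /\<^sub>R norm x) -` A)"
    using assms(1) m by (subst emeasure_distr) (auto simp: measurable_def)
  also have "\<dots> = emeasure lborel (ball 0 1 \<inter> ((\<lambda>x::'a. x /\<^sub>R norm x) -` A)) / emeasure lborel (ball (0::'a) 1)"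
    using v by (subst emeasure_uniform_measure) auto
  also have "ball 0 1 \<inter> ((\<lambda>x::'a. x /\<^sub>R norm x) -` A) = {x. norm x < 1 \<and> x /\<^sub>R norm x \<in> A}"
    by auto
  finally show ?thesis .
qed

lemma prob_space_sphere_measure: "prob_space (sphere_measure :: 'a::euclidean_space measure)"
proof
  have f: "emeasure lborel (ball (0::'a) 1) < \<infinity>"
    using emeasure_lborel_ball_finite by (simp add: less_top)
  have p: "emeasure lborel (ball (0::'a) 1) > 0"
    using content_ball_pos[of 1 "0::'a"] by (simp add: emeasure_lborel_ball_finite measure_def enn2real_positive_iff)
  have eq: "{x::'a. norm x < 1 \<and> x /\<^sub>R norm x \<in> sphere 0 1} = ball 0 1 - {0}"
    by auto
  have "emeasure lborel (ball (0::'a) 1 - {0}) = emeasure lborel (ball (0::'a) 1)"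
    by (subst emeasure_Diff) auto
  then show "emeasure (sphere_measure :: 'a measure) (space sphere_measure) = 1"
    using emeasure_sphere_measure[of "sphere (0::'a) 1"] f p
    unfolding space_sphere_measure eq by (simp add: ennreal_divide_self)
qed

definition sphere_integral :: "('a::euclidean_space \<Rightarrow> real) \<Rightarrow> real" where
  "sphere_integral f = (\<integral>x. f x \<partial>sphere_measure)"

definition L2_sphere :: "('a::euclidean_space \<Rightarrow> real) set" where
  "L2_sphere = {f \<in> borel_measurable sphere_measure. integrable sphere_measure (\<lambda>x. (f x)\<^sup>2)}"

definition laplacian :: "('a::euclidean_space \<Rightarrow> real) \<Rightarrow> 'a \<Rightarrow> real" where
  "laplacian p x = (\<Sum>b\<in>Basis. (deriv ^^ 2) (\<lambda>t. p (x + t *\<^sub>R b)) 0)"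

definition homogeneous_harmonic_polynomial :: "nat \<Rightarrow> ('a::euclidean_space \<Rightarrow> real) \<Rightarrow> bool" where
  "homogeneous_harmonic_polynomial l p \<longleftrightarrow>
     real_polynomial_function p \<and>
     (\<forall>t x. p (t *\<^sub>R x) = t ^ l * p x) \<and>
     (\<forall>x. laplacian p x = 0)"

text \<open>
  Functions on the sphere are represented by functions on the ambient space whose values off
  the sphere are irrelevant.
\<close>

definition spherical_harmonics :: "nat \<Rightarrow> ('a::euclidean_space \<Rightarrow> real) set" where
  "spherical_harmonics l =
     {f. \<exists>p. homogeneous_harmonic_polynomial l p \<and> (\<forall>x\<in>sphere 0 1. f x = p x)}"

text \<open>
  \<open>Y l 1, \<dots>, Y l (Z l)\<close> is an orthonormal basis of the spherical harmonics of degree \<open>l\<close>, for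
  every \<open>l\<close>; in particular \<open>Z l\<close> is the dimension of that space.
\<close>

definition spherical_harmonic_basis ::
    "(nat \<Rightarrow> nat) \<Rightarrow> (nat \<Rightarrow> nat \<Rightarrow> 'a::euclidean_space \<Rightarrow> real) \<Rightarrow> bool" where
  "spherical_harmonic_basis Z Y \<longleftrightarrow> (\<forall>l.
     (\<forall>k\<in>{1..Z l}. Y l k \<in> spherical_harmonics l) \<and>
     (\<forall>j\<in>{1..Z l}. \<forall>k\<in>{1..Z l}.
        sphere_integral (\<lambda>x. Y l j x * Y l k x) = (if j = k then 1 else 0)) \<and>
     (\<forall>f\<in>spherical_harmonics l. \<exists>c. \<forall>x\<in>sphere 0 1. f x = (\<Sum>k=1..Z l. c k * Y l k x)))"

definition fourier_coeff ::
    "(nat \<Rightarrow> nat \<Rightarrow> 'a::euclidean_space \<Rightarrow> real) \<Rightarrow> ('a \<Rightarrow> real) \<Rightarrow> nat \<Rightarrow> nat \<Rightarrow> real" where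
  "fourier_coeff Y f l k = sphere_integral (\<lambda>x. f x * Y l k x)"

definition eigval :: "nat \<Rightarrow> nat \<Rightarrow> real" where
  "eigval d l = real l * (real l + real d - 1)"

definition sobolev_weight :: "nat \<Rightarrow> real \<Rightarrow> nat \<Rightarrow> real" where
  "sobolev_weight d \<gamma> l =
     (1 + eigval d l) powr (real d / 2) * ln (3 + eigval d l) powr (2 * \<gamma>)"

definition sobolev_term ::
    "nat \<Rightarrow> real \<Rightarrow> (nat \<Rightarrow> nat) \<Rightarrow> (nat \<Rightarrow> nat \<Rightarrow> 'a::euclidean_space \<Rightarrow> real) \<Rightarrow>
     ('a \<Rightarrow> real) \<Rightarrow> nat \<Rightarrow> real" where
  "sobolev_term d \<gamma> Z Y f l =
     sobolev_weight d \<gamma> l * (\<Sum>k=1..Z l. \<bar>fourier_coeff Y f l k\<bar>\<^sup>2)"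

definition sobolev_space ::
    "nat \<Rightarrow> real \<Rightarrow> (nat \<Rightarrow> nat) \<Rightarrow> (nat \<Rightarrow> nat \<Rightarrow> 'a::euclidean_space \<Rightarrow> real) \<Rightarrow>
     ('a \<Rightarrow> real) set" where
  "sobolev_space d \<gamma> Z Y = {f \<in> L2_sphere. summable (sobolev_term d \<gamma> Z Y f)}"

definition sobolev_norm ::
    "nat \<Rightarrow> real \<Rightarrow> (nat \<Rightarrow> nat) \<Rightarrow> (nat \<Rightarrow> nat \<Rightarrow> 'a::euclidean_space \<Rightarrow> real) \<Rightarrow>
     ('a \<Rightarrow> real) \<Rightarrow> real" where
  "sobolev_norm d \<gamma> Z Y f = sqrt (\<Sum>l. sobolev_term d \<gamma> Z Y f l)"

definition cubature :: "nat \<Rightarrow> (nat \<Rightarrow> 'a) \<Rightarrow> (nat \<Rightarrow> real) \<Rightarrow> ('a \<Rightarrow> real) \<Rightarrow> real" where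
  "cubature N x \<omega> f = (\<Sum>i=1..N. \<omega> i * f (x i))"

text \<open>
  The supremum is taken in the extended reals. Elements of \<open>B\<close> enter through their continuous
  representatives, since point values are evaluated.
\<close>

definition wce ::
    "(('a::euclidean_space \<Rightarrow> real) \<Rightarrow> real) \<Rightarrow> ('a \<Rightarrow> real) set \<Rightarrow> (('a \<Rightarrow> real) \<Rightarrow> real) \<Rightarrow> ereal" where
  "wce Q B nrm =
     (SUP f\<in>{f \<in> B. continuous_on (sphere 0 1) f \<and> nrm f \<le> 1}. ereal \<bar>Q f - sphere_integral f\<bar>)"

end

theory Submission
  imports Defs
begin

text \<open>
  Let \<open>P\<close> be the space of restrictions to the sphere of the forms of degree \<open>L\<close>. It is invariant
  under rotations, so an orthonormal basis \<open>\<phi>\<^sub>1, \<dots>, \<phi>\<^sub>D\<close> of it satisfies \<open>\<Sum>\<phi>\<^sub>j\<^sup>2 = D\<close> pointwise.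
  The elements of \<open>P\<close> vanishing at the \<open>N\<close> nodes contain an orthonormal system \<open>\<psi>\<close> of size
  \<open>D - N\<close> with \<open>\<Sum>\<psi>\<^sub>j\<^sup>2 \<le> \<Sum>\<phi>\<^sub>j\<^sup>2\<close>. The function \<open>f = \<Sum>\<psi>\<^sub>j\<^sup>2\<close> vanishes at the nodes, satisfies
  \<open>0 \<le> f \<le> D\<close>, and has integral \<open>D - N\<close>, which is at least \<open>D / 2\<close> as soon as \<open>D \<ge> 2 N\<close>.
  Being a form of degree \<open>2 L\<close>, it has no Fourier coefficients of degree above \<open>2 L\<close>, so its
  norm is at most \<open>D\<close> times the square root of the weight at \<open>2 L\<close>. Since \<open>D\<close> grows
  like \<open>L\<^sup>d\<close>, one may take \<open>L\<close> of order \<open>N\<close> to the power \<open>1 / d\<close>.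
\<close>

section \<open>Rotation invariance of the surface measure\<close>

text \<open>The norm is defined by Fourier coefficients, so a bump placed away from the nodes would
  call for decay estimates. For a polynomial the series is finite, and monotone weights together
  with Bessel's inequality bound it. The difficulty is to keep the mean of a nonnegative polynomial
  comparable to its maximum although it has \<open>N\<close> prescribed zeros. The diagonal of the
  reproducing kernel starts with both equal to \<open>D\<close>; imposing the zeros lowers the mean
  by \<open>N\<close> and does not raise the maximum. Afterwards \<open>D\<close> cancels between
  integral and norm, so only \<open>D \<ge> 2 * N\<close> has to be secured, which interpolation on
  a grid does. Rotation invariance enters twice: it makes the kernel diagonal constant, and in
  differentiated form it allows integration by parts along rotations. The latter makes the spherical
  Laplacian self-adjoint, which separates harmonics from all forms of lower degree.\<close>

lemma nn_integral_lborel_shift: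
  fixes f :: "'a::euclidean_space \<Rightarrow> ennreal"
  assumes [measurable]: "f \<in> borel_measurable borel"
  shows "(\<integral>\<^sup>+x. f (c + x) \<partial>lborel) = (\<integral>\<^sup>+x. f x \<partial>lborel)"
  by (subst lborel_distr_plus[of c, symmetric], subst nn_integral_distr) auto

lemma nn_integral_lborel_reflect:
  fixes f :: "'a::euclidean_space \<Rightarrow> ennreal"
  assumes [measurable]: "f \<in> borel_measurable borel"
  shows "(\<integral>\<^sup>+x. f (c - x) \<partial>lborel) = (\<integral>\<^sup>+x. f x \<partial>lborel)"
  by (subst (2) lborel_affine[of "-1" c]) (auto simp: density_1 nn_integral_distr)

lemma orthogonal_transformation_borel_measurable:
  fixes R :: "'a::euclidean_space \<Rightarrow> 'a"
  assumes "orthogonal_transformation R"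
  shows "R \<in> borel_measurable borel"
  by (intro borel_measurable_continuous_onI linear_continuous_on linear_conv_bounded_linear[THEN iffD1])
     (use assms in \<open>simp add: orthogonal_transformation_def\<close>)

text \<open>
  The usual uniqueness argument for Haar measure: both sides of the final equation are the
  iterated integrals of \<open>\<one>\<^sub>A(x) \<one>\<^sub>B(R y - x)\<close>, where \<open>B\<close> is the unit ball.
\<close>

lemma distr_lborel_orthogonal_transformation:
  fixes R :: "'a::euclidean_space \<Rightarrow> 'a"
  assumes R: "orthogonal_transformation R"
  shows "distr lborel borel R = lborel"
proof (rule measure_eqI)
  fix A :: "'a set" assume "A \<in> sets (distr lborel borel R)"
  then have A[measurable]: "A \<in> sets borel" by simp
  note [measurable] = orthogonal_transformation_borel_measurable[OF R]
  define B where "B = ball (0::'a) 1"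
  have B[measurable]: "B \<in> sets borel" by (simp add: B_def)
  have lin: "linear R" and bij: "bij R"
    using R by (auto simp: orthogonal_transformation_def orthogonal_transformation_bij)
  \<comment> \<open>Since \<open>R\<close> is onto, a translation of the image is the image of a
    translation, and Lebesgue measure ignores the latter.\<close>
  have shift: "(\<integral>\<^sup>+y. f (R y - x) \<partial>lborel) = (\<integral>\<^sup>+y. f (R y) \<partial>lborel)"
    if [measurable]: "f \<in> borel_measurable borel" for f :: "'a \<Rightarrow> ennreal" and x
  proof -
    obtain z where z: "R z = x" using bij by (metis bij_pointE)
    have "(\<integral>\<^sup>+y. f (R y - x) \<partial>lborel) = (\<integral>\<^sup>+y. f (R (- z + y)) \<partial>lborel)"
      by (simp add: z[symmetric] linear_diff[OF lin] linear_add[OF lin] linear_neg[OF lin])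
    also have "\<dots> = (\<integral>\<^sup>+y. f (R y) \<partial>lborel)"
      by (rule nn_integral_lborel_shift[where f = "\<lambda>y. f (R y)"]) measurable
    finally show ?thesis .
  qed
  \<comment> \<open>A linear bijection would in general scale volume by a constant; that
    \<open>R\<close> preserves the ball forces this constant to be 1.\<close>
  have RB: "indicator B (R y) = (indicator B y :: ennreal)" for y
    using orthogonal_transformation_norm[OF R] by (simp add: B_def indicator_def)
  have ind: "(\<integral>\<^sup>+y. indicator A (R y) \<partial>lborel) = emeasure (distr lborel borel R) A"
    by (subst nn_integral_indicator[symmetric], simp, subst nn_integral_distr) auto
  have "emeasure lborel A * emeasure lborel B
      = (\<integral>\<^sup>+x. (\<integral>\<^sup>+y. indicator A x * indicator B (R y - x) \<partial>lborel) \<partial>lborel)"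
    by (simp add: nn_integral_cmult shift[of "indicator B"] RB nn_integral_multc)
  also have "\<dots> = (\<integral>\<^sup>+y. (\<integral>\<^sup>+x. indicator A x * indicator B (R y - x) \<partial>lborel) \<partial>lborel)"
    by (rule lborel_pair.Fubini') measurable
  also have "\<dots> = (\<integral>\<^sup>+y. (\<integral>\<^sup>+x. indicator A (R y - x) * indicator B x \<partial>lborel) \<partial>lborel)"
  proof (rule nn_integral_cong)
    fix y
    show "(\<integral>\<^sup>+x. indicator A x * indicator B (R y - x) \<partial>lborel)
        = (\<integral>\<^sup>+x. indicator A (R y - x) * indicator B x \<partial>lborel)"
      using nn_integral_lborel_reflect[of "\<lambda>x. indicator A x * indicator B (R y - x)" "R y"]
      by simp
  qed
  also have "\<dots> = (\<integral>\<^sup>+x. (\<integral>\<^sup>+y. indicator A (R y - x) * indicator B x \<partial>lborel) \<partial>lborel)"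
    by (rule lborel_pair.Fubini') measurable
  also have "\<dots> = emeasure (distr lborel borel R) A * emeasure lborel B"
    by (simp add: nn_integral_multc shift[of "indicator A"] ind nn_integral_cmult)
  finally have "emeasure lborel A * emeasure lborel B
    = emeasure (distr lborel borel R) A * emeasure lborel B" .
  moreover have "emeasure lborel B \<noteq> \<infinity>"
    using emeasure_lborel_ball_finite[of "0::'a" 1] by (simp add: B_def less_top[symmetric])
  moreover have "emeasure lborel B \<noteq> 0"
    using content_ball_pos[of 1 "0::'a"]
    by (auto simp: B_def measure_def)
  ultimately show "emeasure (distr lborel borel R) A = emeasure lborel A"
    by (metis ennreal_mult_cancel_left infinity_ennreal_def mult.commute)
qed simp

text \<open>Reduces integrals over the sphere to Lebesgue integrals over the ball, where the
  invariance just obtained applies.\<close>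

lemma sphere_integral_eq_ball_integral:
  fixes g :: "'a::euclidean_space \<Rightarrow> real"
  assumes [measurable]: "g \<in> borel_measurable borel"
  shows "sphere_integral g =
    (\<integral>x. indicator (ball 0 1) x * g (x /\<^sub>R norm x) \<partial>lborel) / measure lborel (ball (0::'a) 1)"
proof -
  let ?U = "uniform_measure lborel (ball (0::'a) 1)"
  have f: "emeasure lborel (ball (0::'a) 1) \<noteq> \<infinity>"
    using emeasure_lborel_ball_finite[of "0::'a" 1] by (simp add: less_top[symmetric])
  have p: "emeasure lborel (ball (0::'a) 1) \<noteq> 0"
    using content_ball_pos[of 1 "0::'a"] by (auto simp: measure_def)
  have [measurable]: "sphere (0::'a) 1 \<in> sets borel" "ball (0::'a) 1 \<in> sets borel" by simp_all
  have "sphere_integral g = (\<integral>x. indicator (sphere 0 1) x * g x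
          \<partial>distr ?U borel (\<lambda>x. x /\<^sub>R norm x))"
    unfolding sphere_integral_def sphere_measure_def
    by (subst integral_restrict_space) (auto simp: sets.Int)
  also have "\<dots> = (\<integral>x. indicator (sphere 0 1) (x /\<^sub>R norm x) * g (x /\<^sub>R norm x) \<partial>?U)"
    by (subst integral_distr) auto
  also have "\<dots> = (\<integral>x. g (x /\<^sub>R norm x) \<partial>?U)"
  proof (rule integral_cong_AE)
    have "AE x in lborel. (x::'a) \<noteq> 0"
      by (rule AE_lborel_singleton)
    then have "AE x in ?U. (x::'a) \<noteq> 0"
      by (intro AE_uniform_measureI) auto
    then show "AE x in ?U. indicator (sphere 0 1) (x /\<^sub>R norm x) * g (x /\<^sub>R norm x) = g (x /\<^sub>R norm x)"
      by eventually_elim (auto simp: indicator_def)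
  qed auto
  also have "?U = density lborel (\<lambda>x. ennreal (indicator (ball 0 1) x / measure lborel (ball (0::'a) 1)))"
    unfolding uniform_measure_def
  proof (rule density_cong)
    show "(\<lambda>x::'a. indicator (ball 0 1) x / emeasure lborel (ball (0::'a) 1)) \<in> borel_measurable lborel"
      "(\<lambda>x::'a. ennreal (indicator (ball 0 1) x / measure lborel (ball (0::'a) 1))) \<in> borel_measurable lborel"
      by measurable
  next
    show "AE x in lborel. indicator (ball 0 1) (x::'a) / emeasure lborel (ball (0::'a) 1) =
       ennreal (indicator (ball 0 1) x / measure lborel (ball (0::'a) 1))"
    proof (rule AE_I2)
    fix x :: 'a
    show "indicator (ball 0 1) x / emeasure lborel (ball (0::'a) 1) =
       ennreal (indicator (ball 0 1) x / measure lborel (ball (0::'a) 1))"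
      using f p content_ball_pos[of 1 "0::'a"]
      by (simp add: emeasure_eq_ennreal_measure top_unique divide_ennreal[symmetric]
           ennreal_indicator)
    qed
  qed
  also have "(\<integral>x. g (x /\<^sub>R norm x) \<partial>\<dots>) =
      (\<integral>x. indicator (ball 0 1) x * g (x /\<^sub>R norm x) / measure lborel (ball (0::'a) 1) \<partial>lborel)"
    by (subst integral_real_density) (auto simp: content_ball_pos less_imp_le)
  finally show ?thesis by simp
qed

section \<open>Integrals of continuous functions over the sphere\<close>

interpretation sphere: prob_space "sphere_measure :: 'a::euclidean_space measure"
  by (rule prob_space_sphere_measure)

lemma sphere_integral_cong:
  "(\<And>x. x \<in> sphere 0 1 \<Longrightarrow> f x = g x) \<Longrightarrow> sphere_integral f = sphere_integral g"
  unfolding sphere_integral_def by (intro Bochner_Integration.integral_cong) auto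

lemma borel_measurable_sphere_measure:
  fixes f :: "'a::euclidean_space \<Rightarrow> real"
  assumes "f \<in> borel_measurable borel"
  shows "f \<in> borel_measurable sphere_measure"
  by (subst measurable_cong_sets[OF sets_sphere_measure refl])
     (rule measurable_restrict_space1[OF assms])

lemma continuous_bounded_on_sphere:
  fixes f :: "'a::euclidean_space \<Rightarrow> real"
  assumes "continuous_on UNIV f"
  obtains B where "\<And>x. x \<in> sphere 0 1 \<Longrightarrow> \<bar>f x\<bar> \<le> B"
proof -
  have "bounded (f ` sphere 0 1)"
    by (intro compact_imp_bounded compact_continuous_image continuous_on_subset[OF assms]) auto
  then show ?thesis using that unfolding bounded_iff by (metis image_eqI real_norm_def)
qed

lemma integrable_sphere_measure:
  fixes f :: "'a::euclidean_space \<Rightarrow> real"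
  assumes "continuous_on UNIV f"
  shows "integrable sphere_measure f"
proof -
  obtain B where "\<And>x. x \<in> sphere 0 1 \<Longrightarrow> \<bar>f x\<bar> \<le> B"
    using continuous_bounded_on_sphere[OF assms] by blast
  then show ?thesis
    by (intro sphere.integrable_const_bound[of _ B] AE_I2 borel_measurable_sphere_measure
          borel_measurable_continuous_onI assms) auto
qed

lemma sphere_integral_add:
  fixes f g :: "'a::euclidean_space \<Rightarrow> real"
  assumes "continuous_on UNIV f" "continuous_on UNIV g"
  shows "sphere_integral (\<lambda>x. f x + g x) = sphere_integral f + sphere_integral g"
  unfolding sphere_integral_def
  by (intro Bochner_Integration.integral_add integrable_sphere_measure assms)

lemma sphere_integral_diff:
  fixes f g :: "'a::euclidean_space \<Rightarrow> real"
  assumes "continuous_on UNIV f" "continuous_on UNIV g"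
  shows "sphere_integral (\<lambda>x. f x - g x) = sphere_integral f - sphere_integral g"
  unfolding sphere_integral_def
  by (intro Bochner_Integration.integral_diff integrable_sphere_measure assms)

lemma sphere_integral_cmult:
  "sphere_integral (\<lambda>x. c * f x) = c * sphere_integral f"
  unfolding sphere_integral_def by simp

lemma sphere_integral_sum:
  fixes f :: "'i \<Rightarrow> 'a::euclidean_space \<Rightarrow> real"
  assumes "\<And>i. i \<in> I \<Longrightarrow> continuous_on UNIV (f i)"
  shows "sphere_integral (\<lambda>x. \<Sum>i\<in>I. f i x) = (\<Sum>i\<in>I. sphere_integral (f i))"
  unfolding sphere_integral_def
  by (intro Bochner_Integration.integral_sum integrable_sphere_measure assms)

lemma sphere_integral_const [simp]:
  "sphere_integral (\<lambda>x::'a::euclidean_space. c) = c"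
  unfolding sphere_integral_def by (simp add: sphere.prob_space del: space_sphere_measure)

lemma sphere_integral_mono:
  fixes f g :: "'a::euclidean_space \<Rightarrow> real"
  assumes "continuous_on UNIV f" "continuous_on UNIV g" "\<And>x. x \<in> sphere 0 1 \<Longrightarrow> f x \<le> g x"
  shows "sphere_integral f \<le> sphere_integral g"
  unfolding sphere_integral_def
  by (intro integral_mono integrable_sphere_measure assms) (use assms(3) in auto)

lemma sphere_integral_nonneg:
  assumes "\<And>x. x \<in> sphere 0 1 \<Longrightarrow> 0 \<le> f x"
  shows "0 \<le> sphere_integral f"
  unfolding sphere_integral_def using assms by (intro Bochner_Integration.integral_nonneg) auto

text \<open>\<open>R\<close> preserves the ball and commutes with the radial projection, so the
  invariance of Lebesgue measure passes to the cone measure.\<close>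

lemma sphere_integral_orthogonal_transformation:
  fixes f :: "'a::euclidean_space \<Rightarrow> real" and R :: "'a \<Rightarrow> 'a"
  assumes R: "orthogonal_transformation R" and f: "continuous_on UNIV f"
  shows "sphere_integral (\<lambda>x. f (R x)) = sphere_integral f"
proof -
  have f'[measurable]: "f \<in> borel_measurable borel"
    using f by (rule borel_measurable_continuous_onI)
  have R'[measurable]: "R \<in> borel_measurable borel"
    by (rule orthogonal_transformation_borel_measurable[OF R])
  have n: "norm (R x) = norm x" for x by (rule orthogonal_transformation_norm[OF R])
  have [measurable]: "ball (0::'a) 1 \<in> sets borel" by simp
  let ?h = "\<lambda>x. indicator (ball 0 1) x * f (x /\<^sub>R norm x)"
  have "(\<integral>x. indicator (ball 0 1) x * f (R (x /\<^sub>R norm x)) \<partial>lborel) = (\<integral>x. ?h (R x) \<partial>lborel)"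
    by (intro Bochner_Integration.integral_cong)
       (auto simp: n indicator_def orthogonal_transformation_scaleR[OF R])
  also have "\<dots> = integral\<^sup>L (distr lborel borel R) ?h"
    by (rule integral_distr[symmetric]) auto
  also have "\<dots> = integral\<^sup>L lborel ?h"
    by (simp add: distr_lborel_orthogonal_transformation[OF R])
  finally show ?thesis
    by (subst (1 2) sphere_integral_eq_ball_integral) (auto simp: inverse_eq_divide)
qed

text \<open>Makes normalisation possible in Gram-Schmidt. The points of the punctured ball that
  project to where \<open>f\<close> is nonzero form a nonempty open set, which cannot be
  null.\<close>

lemma sphere_integral_power2_pos:
  fixes f :: "'a::euclidean_space \<Rightarrow> real"
  assumes f: "continuous_on UNIV f" and y: "y \<in> sphere 0 1" "f y \<noteq> 0"
  shows "0 < sphere_integral (\<lambda>x. (f x)\<^sup>2)"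
proof (rule ccontr)
  assume "\<not> ?thesis"
  then have 0: "sphere_integral (\<lambda>x. (f x)\<^sup>2) = 0"
    using sphere_integral_nonneg[of "\<lambda>x. (f x)\<^sup>2"] by simp
  have "integrable sphere_measure (\<lambda>x. (f x)\<^sup>2)"
    by (intro integrable_sphere_measure continuous_intros f)
  with 0 have ae: "AE x in sphere_measure. f x = 0"
    unfolding sphere_integral_def by (subst (asm) integral_nonneg_eq_0_iff_AE) auto
  have [measurable]: "f \<in> borel_measurable borel"
    using f by (rule borel_measurable_continuous_onI)
  define A where "A = {x \<in> sphere 0 1. f x \<noteq> 0}"
  define U where "U = {x. norm x < 1 \<and> x /\<^sub>R norm x \<in> A}"
  have A: "A \<in> sets borel"
    unfolding A_def by measurable
  have "emeasure sphere_measure A = 0"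
  proof -
    have "A \<in> sets sphere_measure"
      using A by (auto simp: sets_sphere_measure sets_restrict_space_iff A_def)
    then show ?thesis
      using ae by (subst (asm) AE_iff_measurable[where N = A]) (auto simp: A_def)
  qed
  then have "emeasure lborel U / emeasure lborel (ball (0::'a) 1) = 0"
    using emeasure_sphere_measure[of A] A unfolding U_def by (simp add: A_def subset_iff)
  moreover have "emeasure lborel (ball (0::'a) 1) \<noteq> \<infinity>"
    using emeasure_lborel_ball_finite[of "0::'a" 1] by (simp add: less_top[symmetric])
  ultimately have U0: "emeasure lborel U = 0"
    by (simp add: ennreal_divide_eq_0_iff)
  have "open ((ball 0 1 - {0}) \<inter> (\<lambda>x. f (x /\<^sub>R norm x)) -` (- {0}))"
    by (intro continuous_open_preimage continuous_on_compose2[OF f] continuous_intros) auto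
  also have "(ball 0 1 - {0}) \<inter> (\<lambda>x. f (x /\<^sub>R norm x)) -` (- {0}) = U"
    by (auto simp: U_def A_def)
  finally have "open U" .
  have "U \<noteq> {}"
  proof -
    have "(1/2) *\<^sub>R y \<in> U" using y by (auto simp: U_def A_def)
    then show ?thesis by blast
  qed
  with \<open>open U\<close> have "\<not> negligible U" by (rule open_not_negligible)
  moreover have "negligible U"
    using U0 \<open>open U\<close> by (auto simp: negligible_iff_null_sets null_sets_def)
  ultimately show False by contradiction
qed

section \<open>Polynomials and angular derivatives\<close>

text \<open>Phrased with \<open>deriv\<close> so that two applications in the same direction
  reproduce a summand of \<open>laplacian\<close>.\<close>

definition partial_deriv :: "'a::euclidean_space \<Rightarrow> ('a \<Rightarrow> real) \<Rightarrow> 'a \<Rightarrow> real" where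
  "partial_deriv b p x = deriv (\<lambda>t. p (x + t *\<^sub>R b)) 0"

lemma real_polynomial_function_inner [intro]:
  "real_polynomial_function (\<lambda>x::'a::euclidean_space. x \<bullet> a)"
  by (intro real_polynomial_function.intros(1) bounded_linear_inner_left)

lemma continuous_real_polynomial_function:
  "real_polynomial_function p \<Longrightarrow> continuous_on S p"
  by (simp add: continuous_on_polymonial_function real_polynomial_function_eq)

text \<open>\<open>deriv\<close> returns an unspecified value where no derivative exists, so
  existence is settled first; the same induction shows that the derivative is again a
  polynomial.\<close>

lemma real_polynomial_function_directional_derivative:
  fixes p :: "'a::euclidean_space \<Rightarrow> real"
  assumes "real_polynomial_function p"
  shows "\<exists>q. real_polynomial_function q \<and>
    (\<forall>x. ((\<lambda>t. p (x + t *\<^sub>R b)) has_real_derivative q x) (at 0))"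
  using assms
proof induction
  case (linear f)
  then interpret bounded_linear f .
  have "((\<lambda>t. f (x + t *\<^sub>R b)) has_real_derivative f b) (at 0)" for x
    unfolding add scale real_scaleR_def by (auto intro!: derivative_eq_intros)
  then show ?case by (intro exI[of _ "\<lambda>_. f b"]) auto
next
  case (const c)
  show ?case by (intro exI[of _ "\<lambda>_. 0"]) auto
next
  case (add f g)
  then obtain f' g' where fg: "real_polynomial_function f'" "real_polynomial_function g'"
    "\<And>x. ((\<lambda>t. f (x + t *\<^sub>R b)) has_real_derivative f' x) (at 0)"
    "\<And>x. ((\<lambda>t. g (x + t *\<^sub>R b)) has_real_derivative g' x) (at 0)" by blast
  show ?case
    using fg by (intro exI[of _ "\<lambda>x. f' x + g' x"]) (auto intro!: derivative_eq_intros)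
next
  case (mult f g)
  then obtain f' g' where fg: "real_polynomial_function f'" "real_polynomial_function g'"
    "\<And>x. ((\<lambda>t. f (x + t *\<^sub>R b)) has_real_derivative f' x) (at 0)"
    "\<And>x. ((\<lambda>t. g (x + t *\<^sub>R b)) has_real_derivative g' x) (at 0)" by blast
  have "((\<lambda>t. f (x + t *\<^sub>R b) * g (x + t *\<^sub>R b)) has_real_derivative f' x * g x + g' x * f x) (at 0)" for x
    using DERIV_mult[OF fg(3,4), of x x] by simp
  then show ?case
    using fg mult.hyps by (intro exI[of _ "\<lambda>x. f' x * g x + g' x * f x"]) auto
qed

lemma
  fixes p :: "'a::euclidean_space \<Rightarrow> real"
  assumes "real_polynomial_function p"
  shows has_partial_deriv_0:
      "((\<lambda>t. p (x + t *\<^sub>R b)) has_real_derivative partial_deriv b p x) (at 0)"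
    and real_polynomial_function_partial_deriv:
      "real_polynomial_function (partial_deriv b p)"
proof -
  obtain q where q: "real_polynomial_function q"
    "\<And>x. ((\<lambda>t. p (x + t *\<^sub>R b)) has_real_derivative q x) (at 0)"
    using real_polynomial_function_directional_derivative[OF assms, of b] by blast
  have "partial_deriv b p = q"
    using q(2) by (intro ext) (auto simp: partial_deriv_def DERIV_imp_deriv)
  then show "((\<lambda>t. p (x + t *\<^sub>R b)) has_real_derivative partial_deriv b p x) (at 0)"
    "real_polynomial_function (partial_deriv b p)"
    using q by auto
qed

lemma has_partial_deriv:
  fixes p :: "'a::euclidean_space \<Rightarrow> real"
  assumes "real_polynomial_function p"
  shows "((\<lambda>t. p (x + t *\<^sub>R b)) has_real_derivative partial_deriv b p (x + s *\<^sub>R b)) (at s)"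
  using has_partial_deriv_0[OF assms, of "x + s *\<^sub>R b" b]
    DERIV_shift[of "\<lambda>t. p (x + t *\<^sub>R b)" "partial_deriv b p (x + s *\<^sub>R b)" 0 s]
  by (simp add: algebra_simps)

lemma partial_derivI:
  "(\<And>x. ((\<lambda>t. p (x + t *\<^sub>R b)) has_real_derivative q x) (at 0)) \<Longrightarrow> partial_deriv b p = q"
  by (intro ext) (auto simp: partial_deriv_def DERIV_imp_deriv)

lemma laplacian_eq_sum_partial_deriv:
  fixes p :: "'a::euclidean_space \<Rightarrow> real"
  assumes "real_polynomial_function p"
  shows "laplacian p x = (\<Sum>b\<in>Basis. partial_deriv b (partial_deriv b p) x)"
proof -
  have "deriv (\<lambda>t. p (x + t *\<^sub>R b)) = (\<lambda>t. partial_deriv b p (x + t *\<^sub>R b))" for b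
    using has_partial_deriv[OF assms] by (intro ext DERIV_imp_deriv)
  then show ?thesis
    by (simp add: laplacian_def numeral_2_eq_2 partial_deriv_def[of _ "partial_deriv _ _"])
qed

lemma partial_deriv_const [simp]: "partial_deriv b (\<lambda>x. c) = (\<lambda>x. 0)"
  by (rule partial_derivI) auto

lemma partial_deriv_bounded_linear:
  assumes "bounded_linear f"
  shows "partial_deriv b f = (\<lambda>x. f b)"
proof -
  interpret bounded_linear f by fact
  show ?thesis
    by (rule partial_derivI, unfold add scale real_scaleR_def) (auto intro!: derivative_eq_intros)
qed

lemma partial_deriv_inner [simp]: "partial_deriv b (\<lambda>x. x \<bullet> a) = (\<lambda>x. b \<bullet> a)"
  by (simp add: partial_deriv_bounded_linear bounded_linear_inner_left)

lemma partial_deriv_add: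
  assumes "real_polynomial_function p" "real_polynomial_function q"
  shows "partial_deriv b (\<lambda>x. p x + q x) = (\<lambda>x. partial_deriv b p x + partial_deriv b q x)"
  by (intro partial_derivI DERIV_add has_partial_deriv_0 assms)

lemma partial_deriv_diff:
  assumes "real_polynomial_function p" "real_polynomial_function q"
  shows "partial_deriv b (\<lambda>x. p x - q x) = (\<lambda>x. partial_deriv b p x - partial_deriv b q x)"
  by (intro partial_derivI DERIV_diff has_partial_deriv_0 assms)

lemma partial_deriv_mult:
  assumes "real_polynomial_function p" "real_polynomial_function q"
  shows "partial_deriv b (\<lambda>x. p x * q x) =
    (\<lambda>x. partial_deriv b p x * q x + partial_deriv b q x * p x)"
proof (rule partial_derivI)
  fix x
  show "((\<lambda>t. p (x + t *\<^sub>R b) * q (x + t *\<^sub>R b)) has_real_derivative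
      partial_deriv b p x * q x + partial_deriv b q x * p x) (at 0)"
    using DERIV_mult[OF has_partial_deriv_0[OF assms(1)] has_partial_deriv_0[OF assms(2)], of x b x b]
    by simp
qed

lemma partial_deriv_commute:
  fixes p :: "'a::euclidean_space \<Rightarrow> real"
  assumes "real_polynomial_function p"
  shows "partial_deriv a (partial_deriv b p) = partial_deriv b (partial_deriv a p)"
  using assms
proof induction
  case (linear f)
  then show ?case by (simp add: partial_deriv_bounded_linear)
next
  case (add f g)
  then show ?case
    by (simp add: partial_deriv_add real_polynomial_function_partial_deriv)
next
  case (mult f g)
  then show ?case
    by (simp add: partial_deriv_add partial_deriv_mult real_polynomial_function_partial_deriv
        real_polynomial_function.intros(4) algebra_simps)
qed simp

lemma has_derivative_real_polynomial_function:
  fixes p :: "'a::euclidean_space \<Rightarrow> real"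
  assumes "real_polynomial_function p"
  shows "(p has_derivative (\<lambda>h. \<Sum>b\<in>Basis. (h \<bullet> b) * partial_deriv b p x)) (at x)"
proof -
  obtain F where F: "(p has_derivative F) (at x)"
    using differentiable_at_real_polynomial_function[OF assms] unfolding differentiable_def by blast
  interpret F: linear F using F by (rule has_derivative_linear)
  have Fb: "F b = partial_deriv b p x" for b
  proof -
    have "((\<lambda>t. p (x + t *\<^sub>R b)) has_derivative (\<lambda>t. F (t *\<^sub>R b))) (at 0)"
      by (rule has_derivative_compose[of _ "\<lambda>t. t *\<^sub>R b", where g = p])
         (use F in \<open>auto intro!: derivative_eq_intros\<close>)
    then have "((\<lambda>t. p (x + t *\<^sub>R b)) has_real_derivative F b) (at 0)"
      by (simp add: has_field_derivative_def F.scale mult_commute_abs)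
    then show ?thesis using has_partial_deriv_0[OF assms] DERIV_unique by blast
  qed
  have "F h = (\<Sum>b\<in>Basis. (h \<bullet> b) * partial_deriv b p x)" for h
  proof -
    have "F h = F (\<Sum>b\<in>Basis. (h \<bullet> b) *\<^sub>R b)" by (simp add: euclidean_representation)
    also have "\<dots> = (\<Sum>b\<in>Basis. (h \<bullet> b) * F b)" by (simp add: F.sum F.scale)
    finally show ?thesis by (simp add: Fb)
  qed
  then have "F = (\<lambda>h. \<Sum>b\<in>Basis. (h \<bullet> b) * partial_deriv b p x)" ..
  with F show ?thesis by simp
qed

lemma has_real_derivative_along_curve:
  fixes p :: "'a::euclidean_space \<Rightarrow> real"
  assumes "real_polynomial_function p" "(c has_vector_derivative c') (at t)"
  shows "((\<lambda>t. p (c t)) has_real_derivative (\<Sum>b\<in>Basis. (c' \<bullet> b) * partial_deriv b p (c t))) (at t)"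
proof -
  have "((\<lambda>t. p (c t)) has_derivative
      (\<lambda>s. \<Sum>b\<in>Basis. ((s *\<^sub>R c') \<bullet> b) * partial_deriv b p (c t))) (at t)"
    using has_derivative_compose[OF assms(2)[unfolded has_vector_derivative_def]
        has_derivative_real_polynomial_function[OF assms(1), of "c t"]] .
  moreover have "(\<lambda>s. \<Sum>b\<in>Basis. ((s *\<^sub>R c') \<bullet> b) * partial_deriv b p (c t)) =
      (*) (\<Sum>b\<in>Basis. (c' \<bullet> b) * partial_deriv b p (c t))"
    by (auto simp: fun_eq_iff sum_distrib_left mult_ac intro!: sum.cong)
  ultimately show ?thesis
    by (simp only: has_field_derivative_def)
qed

text \<open>The infinitesimal generator of the rotations in the plane of \<open>a\<close> and
  \<open>b\<close>: a derivative tangent to all spheres around the origin.\<close>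

definition angular_deriv :: "'a::euclidean_space \<Rightarrow> 'a \<Rightarrow> ('a \<Rightarrow> real) \<Rightarrow> 'a \<Rightarrow> real" where
  "angular_deriv a b p x = (x \<bullet> a) * partial_deriv b p x - (x \<bullet> b) * partial_deriv a p x"

lemma real_polynomial_function_angular_deriv:
  assumes "real_polynomial_function p"
  shows "real_polynomial_function (angular_deriv a b p)"
  unfolding angular_deriv_def[abs_def]
  using assms by (intro real_polynomial_function_diff real_polynomial_function.intros(4)
      real_polynomial_function_partial_deriv real_polynomial_function_inner)

lemma angular_deriv_mult:
  assumes "real_polynomial_function p" "real_polynomial_function q"
  shows "angular_deriv a b (\<lambda>x. p x * q x) x =
    p x * angular_deriv a b q x + q x * angular_deriv a b p x"
  using assms by (simp add: angular_deriv_def partial_deriv_mult algebra_simps)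

text \<open>For orthonormal \<open>a\<close> and \<open>b\<close>, the rotation by the angle
  \<open>t\<close> from \<open>a\<close> towards \<open>b\<close>, as the identity plus a correction
  that acts only in their plane.\<close>

definition plane_rotation :: "'a::euclidean_space \<Rightarrow> 'a \<Rightarrow> real \<Rightarrow> 'a \<Rightarrow> 'a" where
  "plane_rotation a b t x = x + (cos t - 1) *\<^sub>R ((x \<bullet> a) *\<^sub>R a + (x \<bullet> b) *\<^sub>R b)
     + sin t *\<^sub>R ((x \<bullet> a) *\<^sub>R b - (x \<bullet> b) *\<^sub>R a)"

lemma orthogonal_transformation_plane_rotation:
  fixes a b :: "'a::euclidean_space"
  assumes ab: "a \<in> Basis" "b \<in> Basis" "a \<noteq> b"
  shows "orthogonal_transformation (plane_rotation a b t)"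
proof -
  have [simp]: "a \<bullet> a = 1" "b \<bullet> b = 1" "a \<bullet> b = 0" "b \<bullet> a = 0"
    using ab by (auto simp: inner_Basis)
  have "linear (plane_rotation a b t)"
    by (rule linearI) (simp_all add: plane_rotation_def algebra_simps inner_add_left)
  moreover have "norm (plane_rotation a b t x) = norm x" for x
  proof -
    have "plane_rotation a b t x \<bullet> plane_rotation a b t x
        = x \<bullet> x + ((x \<bullet> a)\<^sup>2 + (x \<bullet> b)\<^sup>2) * ((cos t)\<^sup>2 + (sin t)\<^sup>2 - 1)"
      unfolding plane_rotation_def
      by (simp add: inner_add_left inner_add_right inner_diff_left inner_diff_right
            inner_commute[of a x] inner_commute[of b x] power2_eq_square algebra_simps
            del: sin_cos_squared_add sin_cos_squared_add2 sin_cos_squared_add3)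
    then show ?thesis by (simp add: norm_eq_sqrt_inner)
  qed
  ultimately show ?thesis by (simp add: orthogonal_transformation)
qed

text \<open>The rotations are the flow of the field behind \<open>angular_deriv\<close>, so the
  formula holds at every angle. The mean value theorem below uses it away from
  \<open>t = 0\<close>.\<close>

lemma has_real_derivative_plane_rotation:
  fixes p :: "'a::euclidean_space \<Rightarrow> real"
  assumes p: "real_polynomial_function p" and ab: "a \<in> Basis" "b \<in> Basis" "a \<noteq> b"
  shows "((\<lambda>t. p (plane_rotation a b t x)) has_real_derivative
    angular_deriv a b p (plane_rotation a b t x)) (at t)"
proof -
  let ?c' = "(- sin t) *\<^sub>R ((x \<bullet> a) *\<^sub>R a + (x \<bullet> b) *\<^sub>R b) + cos t *\<^sub>R ((x \<bullet> a) *\<^sub>R b - (x \<bullet> b) *\<^sub>R a)"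
  let ?d = "\<lambda>e. partial_deriv e p (plane_rotation a b t x)"
  have i: "a \<bullet> a = 1" "b \<bullet> b = 1" "a \<bullet> b = 0" "b \<bullet> a = 0"
    using ab by (auto simp: inner_Basis)
  have c: "((\<lambda>t. plane_rotation a b t x) has_vector_derivative ?c') (at t)"
    unfolding plane_rotation_def
    by (auto intro!: derivative_eq_intros simp: has_real_derivative_iff_has_vector_derivative[symmetric])
  have "(\<Sum>e\<in>Basis. (?c' \<bullet> e) * ?d e) = (?c' \<bullet> a) * ?d a + (?c' \<bullet> b) * ?d b"
  proof -
    have "(\<Sum>e\<in>Basis. (?c' \<bullet> e) * ?d e) = (\<Sum>e\<in>{a, b}. (?c' \<bullet> e) * ?d e)"
    proof (rule sum.mono_neutral_right)
      show "\<forall>e\<in>Basis - {a, b}. ?c' \<bullet> e * ?d e = 0"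
        using ab by (auto simp: inner_add_left inner_diff_left inner_Basis)
    qed (use ab in auto)
    then show ?thesis using ab by simp
  qed
  also have "\<dots> = angular_deriv a b p (plane_rotation a b t x)"
    by (simp add: angular_deriv_def i plane_rotation_def inner_add_left inner_diff_left algebra_simps)
  finally show ?thesis
    using has_real_derivative_along_curve[OF p c] by simp
qed

section \<open>Orthogonality of spherical harmonics to lower degrees\<close>

text \<open>The integral of \<open>p\<close> composed with a rotation does not depend on the angle,
  so its derivative at angle 0 vanishes. Dominated convergence along the angles
  \<open>1 / (n + 1)\<close> moves the derivative under the integral.\<close>

lemma sphere_integral_angular_deriv:
  fixes p :: "'a::euclidean_space \<Rightarrow> real"
  assumes p: "real_polynomial_function p" and ab: "a \<in> Basis" "b \<in> Basis"
  shows "sphere_integral (angular_deriv a b p) = 0"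
proof (cases "a = b")
  case True
  then show ?thesis by (simp add: angular_deriv_def[abs_def])
next
  case False
  let ?R = "plane_rotation a b" and ?h = "\<lambda>n. inverse (real (Suc n))"
  let ?s = "\<lambda>n x. (p (?R (?h n) x) - p x) / ?h n"
  note orth = orthogonal_transformation_plane_rotation[OF ab False]
  note cont = continuous_real_polynomial_function[OF p, of UNIV]
  have R0: "?R 0 x = x" for x by (simp add: plane_rotation_def)
  have contR: "continuous_on UNIV (?R t)" for t
    using orth[of t] by (simp add: orthogonal_transformation_linear linear_continuous_on linear_linear)
  have contpR: "continuous_on UNIV (\<lambda>x. p (?R t x))" for t
    by (rule continuous_on_compose2[OF cont contR]) auto
  have conts: "continuous_on UNIV (?s n)" for n
    by (intro continuous_intros contpR cont) auto
  have conta: "continuous_on UNIV (angular_deriv a b p)"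
    by (intro continuous_real_polynomial_function real_polynomial_function_angular_deriv p)
  obtain B where B: "\<And>x. x \<in> sphere 0 1 \<Longrightarrow> \<bar>angular_deriv a b p x\<bar> \<le> B"
    using continuous_bounded_on_sphere[OF conta] by blast
  have "(\<lambda>n. sphere_integral (?s n)) \<longlonglongrightarrow> sphere_integral (angular_deriv a b p)"
    unfolding sphere_integral_def
  proof (rule integral_dominated_convergence[where w = "\<lambda>_. B"])
    show "angular_deriv a b p \<in> borel_measurable sphere_measure"
      "\<And>n. ?s n \<in> borel_measurable sphere_measure"
      by (intro borel_measurable_sphere_measure borel_measurable_continuous_onI conta conts)+
    show "AE x in sphere_measure. (\<lambda>n. ?s n x) \<longlonglongrightarrow> angular_deriv a b p x"
    proof (rule AE_I2)
      fix x
      have "((\<lambda>t. (p (?R t x) - p x) / t) \<longlongrightarrow> angular_deriv a b p x) (at 0)"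
        using has_real_derivative_plane_rotation[OF p ab False, of x 0]
        by (simp add: has_field_derivative_iff R0)
      then show "(\<lambda>n. ?s n x) \<longlonglongrightarrow> angular_deriv a b p x"
        by (rule filterlim_compose)
           (use LIMSEQ_inverse_real_of_nat in \<open>simp add: filterlim_at\<close>)
    qed
    show "AE x in sphere_measure. norm (?s n x) \<le> B" for n
    proof (rule AE_I2)
      fix x :: 'a assume "x \<in> space sphere_measure"
      then have x: "norm x = 1" by simp
      \<comment> \<open>The difference quotient equals an angular derivative at a rotated point,
        which is still on the sphere; hence one bound serves all \<open>n\<close>.\<close>
      obtain z where "p (?R (?h n) x) - p (?R 0 x) = (?h n - 0) * angular_deriv a b p (?R z x)"
        using MVT2[of 0 "?h n" "\<lambda>t. p (?R t x)" "\<lambda>t. angular_deriv a b p (?R t x)"]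
          has_real_derivative_plane_rotation[OF p ab False, of x] by auto
      then have "?s n x = angular_deriv a b p (?R z x)" by (simp add: R0)
      moreover have "?R z x \<in> sphere 0 1"
        using orthogonal_transformation_norm[OF orth] x by simp
      ultimately show "norm (?s n x) \<le> B" using B by simp
    qed
    show "integrable sphere_measure (\<lambda>_::'a. B)"
      by (rule integrable_sphere_measure) auto
  qed
  moreover have "sphere_integral (?s n) = 0" for n
  proof -
    have "sphere_integral (?s n) = sphere_integral (\<lambda>x. inverse (?h n) * (p (?R (?h n) x) - p x))"
      by (simp add: field_simps)
    also have "\<dots> = inverse (?h n) * (sphere_integral (\<lambda>x. p (?R (?h n) x)) - sphere_integral p)"
      by (simp only: sphere_integral_cmult sphere_integral_diff[OF contpR cont])
    finally show ?thesis
      by (simp add: sphere_integral_orthogonal_transformation[OF orth cont])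
  qed
  ultimately show ?thesis by (simp add: LIMSEQ_const_iff)
qed

lemma sphere_integral_by_parts:
  fixes p q :: "'a::euclidean_space \<Rightarrow> real"
  assumes p: "real_polynomial_function p" and q: "real_polynomial_function q"
    and ab: "a \<in> Basis" "b \<in> Basis"
  shows "sphere_integral (\<lambda>x. p x * angular_deriv a b q x) =
    - sphere_integral (\<lambda>x. q x * angular_deriv a b p x)"
proof -
  have "sphere_integral (\<lambda>x. p x * angular_deriv a b q x + q x * angular_deriv a b p x) = 0"
    using sphere_integral_angular_deriv[OF real_polynomial_function.intros(4)[OF p q] ab]
    by (simp add: angular_deriv_mult[OF p q, abs_def, symmetric] eta_contract_eq)
  then show ?thesis
    by (subst (asm) sphere_integral_add)
       (auto intro!: continuous_real_polynomial_function real_polynomial_function.intros(4) p q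
         real_polynomial_function_angular_deriv)
qed

text \<open>Twice the Laplace--Beltrami operator.\<close>

definition angular_laplacian :: "('a::euclidean_space \<Rightarrow> real) \<Rightarrow> 'a \<Rightarrow> real" where
  "angular_laplacian p x =
    (\<Sum>a\<in>Basis. \<Sum>b\<in>Basis. angular_deriv a b (angular_deriv a b p) x)"

text \<open>Integration by parts twice along each rotation: the two signs cancel.\<close>

lemma sphere_integral_angular_laplacian_commute:
  fixes p q :: "'a::euclidean_space \<Rightarrow> real"
  assumes p: "real_polynomial_function p" and q: "real_polynomial_function q"
  shows "sphere_integral (\<lambda>x. p x * angular_laplacian q x) =
    sphere_integral (\<lambda>x. q x * angular_laplacian p x)"
proof -
  note [intro] = real_polynomial_function_angular_deriv
  have *: "sphere_integral (\<lambda>x. p x * angular_laplacian q x) =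
    (\<Sum>a\<in>Basis. \<Sum>b\<in>Basis. sphere_integral (\<lambda>x. p x * angular_deriv a b (angular_deriv a b q) x))"
    if "real_polynomial_function p" "real_polynomial_function q" for p q :: "'a \<Rightarrow> real"
    unfolding angular_laplacian_def sum_distrib_left
    using that
    by (subst sphere_integral_sum, fastforce intro!: continuous_real_polynomial_function
          real_polynomial_function_sum real_polynomial_function.intros(4))
       (intro sum.cong refl sphere_integral_sum continuous_real_polynomial_function
          real_polynomial_function.intros(4) real_polynomial_function_angular_deriv)
  have "sphere_integral (\<lambda>x. p x * angular_deriv a b (angular_deriv a b q) x) =
      sphere_integral (\<lambda>x. q x * angular_deriv a b (angular_deriv a b p) x)"
    if "a \<in> Basis" "b \<in> Basis" for a b
    using sphere_integral_by_parts[OF p real_polynomial_function_angular_deriv[OF q] that, of a b]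
      sphere_integral_by_parts[OF q real_polynomial_function_angular_deriv[OF p] that, of a b]
    by (simp add: mult.commute)
  then show ?thesis
    by (simp add: *[OF p q] *[OF q p])
qed

section \<open>Homogeneous polynomials, Euler's identities and the eigenvalue equation\<close>

definition homogeneous :: "nat \<Rightarrow> ('a::euclidean_space \<Rightarrow> real) \<Rightarrow> bool" where
  "homogeneous m p \<longleftrightarrow> real_polynomial_function p \<and> (\<forall>t x. p (t *\<^sub>R x) = t ^ m * p x)"

lemma homogeneous_polynomial: "homogeneous m p \<Longrightarrow> real_polynomial_function p"
  by (simp add: homogeneous_def)

lemma homogeneous_continuous: "homogeneous m p \<Longrightarrow> continuous_on S p"
  by (simp add: homogeneous_def continuous_real_polynomial_function)

lemma homogeneous_0_partial_deriv:
  assumes "homogeneous 0 p"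
  shows "partial_deriv b p = (\<lambda>x. 0)"
proof -
  \<comment> \<open>The homogeneity law at \<open>t = 0\<close>, where
    \<open>0 ^ 0 = 1\<close>.\<close>
  have "p x = p 0" for x
    using assms unfolding homogeneous_def by (metis power_0 mult_1 scaleR_zero_left)
  then have "p = (\<lambda>x. p 0)" by (intro ext)
  then show ?thesis by (metis partial_deriv_const)
qed

text \<open>Differentiating \<open>p (t *\<^sub>R x + s *\<^sub>R (t *\<^sub>R b))\<close> in
  \<open>s\<close>, once after pulling out \<open>t\<close> by homogeneity and once by the chain
  rule, gives the law times \<open>t\<close>. The value \<open>t = 0\<close> follows by
  continuity.\<close>

lemma homogeneous_partial_deriv:
  fixes p :: "'a::euclidean_space \<Rightarrow> real"
  assumes "homogeneous (Suc m) p"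
  shows "homogeneous m (partial_deriv b p)"
proof -
  note p = homogeneous_polynomial[OF assms]
  have hom: "p (t *\<^sub>R x) = t ^ Suc m * p x" for t x
    using assms by (simp add: homogeneous_def)
  let ?d = "partial_deriv b p"
  have nz: "?d (t *\<^sub>R x) = t ^ m * ?d x" if "t \<noteq> 0" for t x
  proof -
    have "((\<lambda>s. p (t *\<^sub>R x + s *\<^sub>R (t *\<^sub>R b))) has_real_derivative t ^ Suc m * ?d x) (at 0)"
    proof -
      have "((\<lambda>s. t ^ Suc m * p (x + s *\<^sub>R b)) has_real_derivative t ^ Suc m * ?d x) (at 0)"
        by (intro DERIV_cmult has_partial_deriv_0 p)
      also have "(\<lambda>s. t ^ Suc m * p (x + s *\<^sub>R b)) = (\<lambda>s. p (t *\<^sub>R x + s *\<^sub>R (t *\<^sub>R b)))"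
        by (simp only: hom[symmetric] scaleR_add_right scaleR_scaleR mult.commute)
      finally show ?thesis .
    qed
    moreover have "((\<lambda>s. p (t *\<^sub>R x + s *\<^sub>R (t *\<^sub>R b))) has_real_derivative t * ?d (t *\<^sub>R x)) (at 0)"
    proof -
      have "((\<lambda>s. p (t *\<^sub>R x + s *\<^sub>R b)) has_real_derivative ?d (t *\<^sub>R x)) (at (0 * t))"
        using has_partial_deriv_0[OF p] by simp
      from DERIV_chain2[OF this DERIV_cmult_right[OF DERIV_ident]]
      show ?thesis by (simp add: mult.commute)
    qed
    ultimately have "t ^ Suc m * ?d x = t * ?d (t *\<^sub>R x)"
      by (rule DERIV_unique)
    with that show ?thesis by simp
  qed
  have "?d (t *\<^sub>R x) = t ^ m * ?d x" for t x
  proof (cases "t = 0")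
    case True
    have c: "continuous_on UNIV ?d"
      by (intro continuous_real_polynomial_function real_polynomial_function_partial_deriv p)
    have "isCont (\<lambda>t. ?d (t *\<^sub>R x) - t ^ m * ?d x) 0"
    proof -
      have "continuous_on UNIV (\<lambda>t. ?d (t *\<^sub>R x) - t ^ m * ?d x)"
        by (intro continuous_intros continuous_on_compose2[OF c]) auto
      then show ?thesis by (simp add: continuous_on_eq_continuous_at)
    qed
    then have "((\<lambda>t. ?d (t *\<^sub>R x) - t ^ m * ?d x) \<longlongrightarrow> ?d (0 *\<^sub>R x) - 0 ^ m * ?d x) (at 0)"
      by (simp only: isCont_def)
    moreover have "((\<lambda>t. ?d (t *\<^sub>R x) - t ^ m * ?d x) \<longlongrightarrow> 0) (at 0)"
      by (rule Lim_transform_eventually[OF tendsto_const]) (auto simp: eventually_at_filter nz)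
    ultimately have "?d (0 *\<^sub>R x) - 0 ^ m * ?d x = 0"
      by (rule tendsto_unique[rotated]) simp
    with True show ?thesis by simp
  qed (rule nz)
  then show ?thesis
    by (simp add: homogeneous_def real_polynomial_function_partial_deriv p)
qed

lemma homogeneous_euler:
  fixes p :: "'a::euclidean_space \<Rightarrow> real"
  assumes "homogeneous m p"
  shows "(\<Sum>b\<in>Basis. (x \<bullet> b) * partial_deriv b p x) = real m * p x"
proof -
  have "((\<lambda>t. p (t *\<^sub>R x)) has_real_derivative (\<Sum>b\<in>Basis. (x \<bullet> b) * partial_deriv b p (1 *\<^sub>R x))) (at 1)"
    by (rule has_real_derivative_along_curve[OF homogeneous_polynomial[OF assms]])
       (auto intro!: derivative_eq_intros)
  moreover have "((\<lambda>t. p (t *\<^sub>R x)) has_real_derivative real m * p x) (at 1)"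
    using assms by (auto simp: homogeneous_def intro!: derivative_eq_intros)
  ultimately show ?thesis
    using DERIV_unique by fastforce
qed

text \<open>Euler's identity for \<open>p\<close>, combined with the same identity for its partial
  derivatives, which are homogeneous of one degree less.\<close>

lemma homogeneous_euler2:
  fixes p :: "'a::euclidean_space \<Rightarrow> real"
  assumes "homogeneous m p"
  shows "(\<Sum>a\<in>Basis. \<Sum>b\<in>Basis. (x \<bullet> a) * (x \<bullet> b) * partial_deriv a (partial_deriv b p) x)
    = real m * (real m - 1) * p x"
proof (cases m)
  case 0
  with assms show ?thesis by (simp add: homogeneous_0_partial_deriv)
next
  case (Suc k)
  have "(\<Sum>a\<in>Basis. \<Sum>b\<in>Basis. (x \<bullet> a) * (x \<bullet> b) * partial_deriv a (partial_deriv b p) x)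
     = (\<Sum>b\<in>Basis. (x \<bullet> b) * (\<Sum>a\<in>Basis. (x \<bullet> a) * partial_deriv a (partial_deriv b p) x))"
    by (subst sum.swap) (simp add: sum_distrib_left mult_ac)
  also have "\<dots> = (\<Sum>b\<in>Basis. (x \<bullet> b) * (real k * partial_deriv b p x))"
    using homogeneous_euler[OF homogeneous_partial_deriv[of k p]] assms Suc by simp
  also have "\<dots> = real k * (\<Sum>b\<in>Basis. (x \<bullet> b) * partial_deriv b p x)"
    by (simp add: sum_distrib_left mult_ac)
  finally show ?thesis using Suc by (simp add: homogeneous_euler[OF assms])
qed

text \<open>The first-order terms arise when the outer field differentiates the coordinates in the
  inner one. The factor \<open>a \<bullet> b\<close> covers the diagonal \<open>a = b\<close>, where
  everything cancels.\<close>

lemma angular_deriv_angular_deriv: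
  fixes p :: "'a::euclidean_space \<Rightarrow> real"
  assumes p: "real_polynomial_function p" and ab: "a \<in> Basis" "b \<in> Basis"
  shows "angular_deriv a b (angular_deriv a b p) x =
    (x \<bullet> a)\<^sup>2 * partial_deriv b (partial_deriv b p) x + (x \<bullet> b)\<^sup>2 * partial_deriv a (partial_deriv a p) x
    - 2 * ((x \<bullet> a) * (x \<bullet> b) * partial_deriv a (partial_deriv b p) x)
    + (a \<bullet> b) * ((x \<bullet> a) * partial_deriv b p x + (x \<bullet> b) * partial_deriv a p x)
    - (x \<bullet> a) * partial_deriv a p x - (x \<bullet> b) * partial_deriv b p x"
proof -
  have "partial_deriv c (angular_deriv a b p) x =
      (c \<bullet> a) * partial_deriv b p x + (x \<bullet> a) * partial_deriv c (partial_deriv b p) x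
      - (c \<bullet> b) * partial_deriv a p x - (x \<bullet> b) * partial_deriv c (partial_deriv a p) x" for c
    unfolding angular_deriv_def[abs_def]
    by (simp add: partial_deriv_diff partial_deriv_mult p real_polynomial_function_partial_deriv
        real_polynomial_function.intros(4) real_polynomial_function_inner)
  note d = this
  show ?thesis
    unfolding angular_deriv_def[of a b "angular_deriv a b p"] d
    using ab by (simp add: partial_deriv_commute[OF p, of b a] inner_commute[of b a]
        power2_eq_square algebra_simps)
qed

text \<open>Euler's identities turn all terms except the pure second derivatives into multiples of
  \<open>p\<close>. The factor 2 arises because ordered pairs count each plane twice. In dimension
  \<open>d + 1\<close> the eigenvalue \<open>m * (m + DIM('a) - 2)\<close> is
  \<open>eigval d m\<close>.\<close>

lemma angular_laplacian_homogeneous: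
  fixes p :: "'a::euclidean_space \<Rightarrow> real"
  assumes "homogeneous m p"
  shows "angular_laplacian p x =
    2 * ((norm x)\<^sup>2 * laplacian p x - real m * (real m + real DIM('a) - 2) * p x)"
proof -
  note p = homogeneous_polynomial[OF assms]
  let ?d = "\<lambda>b. partial_deriv b p x" and ?dd = "\<lambda>a b. partial_deriv a (partial_deriv b p) x"
  let ?n = "real DIM('a)"
  have sq: "(\<Sum>a\<in>Basis. (x \<bullet> a)\<^sup>2) = (norm x)\<^sup>2"
    unfolding power2_norm_eq_inner by (subst (2) euclidean_inner) (simp add: power2_eq_square)
  have lap: "(\<Sum>b\<in>Basis. ?dd b b) = laplacian p x"
    by (simp add: laplacian_eq_sum_partial_deriv[OF p])
  have e: "(\<Sum>b\<in>Basis. (x \<bullet> b) * ?d b) = real m * p x"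
    by (rule homogeneous_euler[OF assms])
  have diag: "(\<Sum>a\<in>Basis. \<Sum>b\<in>Basis. (a \<bullet> b) * ((x \<bullet> a) * ?d b + (x \<bullet> b) * ?d a)) = 2 * real m * p x"
  proof -
    have "(\<Sum>b\<in>Basis. (a \<bullet> b) * ((x \<bullet> a) * ?d b + (x \<bullet> b) * ?d a)) = 2 * ((x \<bullet> a) * ?d a)"
      if "a \<in> Basis" for a
    proof -
      have "(\<Sum>b\<in>Basis. (a \<bullet> b) * ((x \<bullet> a) * ?d b + (x \<bullet> b) * ?d a))
        = (\<Sum>b\<in>Basis. if b = a then 2 * ((x \<bullet> a) * ?d a) else 0)"
        using that by (intro sum.cong) (auto simp: inner_Basis)
      then show ?thesis using that by simp
    qed
    then have "(\<Sum>a\<in>Basis. \<Sum>b\<in>Basis. (a \<bullet> b) * ((x \<bullet> a) * ?d b + (x \<bullet> b) * ?d a))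
      = 2 * (\<Sum>a\<in>Basis. (x \<bullet> a) * ?d a)"
      by (simp add: sum_distrib_left)
    then show ?thesis by (simp add: e)
  qed
  have "angular_laplacian p x =
    (\<Sum>a\<in>Basis. \<Sum>b\<in>Basis. (x \<bullet> a)\<^sup>2 * ?dd b b) + (\<Sum>a\<in>Basis. \<Sum>b\<in>Basis. (x \<bullet> b)\<^sup>2 * ?dd a a)
    - 2 * (\<Sum>a\<in>Basis. \<Sum>b\<in>Basis. (x \<bullet> a) * (x \<bullet> b) * ?dd a b)
    + (\<Sum>a\<in>Basis. \<Sum>b\<in>Basis. (a \<bullet> b) * ((x \<bullet> a) * ?d b + (x \<bullet> b) * ?d a))
    - (\<Sum>a\<in>Basis. \<Sum>b\<in>(Basis::'a set). (x \<bullet> a) * ?d a) - (\<Sum>a\<in>(Basis::'a set). \<Sum>b\<in>Basis. (x \<bullet> b) * ?d b)"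
    unfolding angular_laplacian_def sum_distrib_left
    by (simp add: angular_deriv_angular_deriv[OF p] sum.distrib sum_subtractf sum_distrib_left)
  also have "(\<Sum>a\<in>Basis. \<Sum>b\<in>Basis. (x \<bullet> a)\<^sup>2 * ?dd b b) = (norm x)\<^sup>2 * laplacian p x"
    by (simp add: sum_product[symmetric] sq lap)
  also have "(\<Sum>a\<in>Basis. \<Sum>b\<in>Basis. (x \<bullet> b)\<^sup>2 * ?dd a a) = (norm x)\<^sup>2 * laplacian p x"
    by (subst sum.swap) (simp add: sum_product[symmetric] sq lap)
  also have "(\<Sum>a\<in>Basis. \<Sum>b\<in>(Basis::'a set). (x \<bullet> a) * ?d a) = ?n * (real m * p x)"
    by (simp add: sum_distrib_left[symmetric] e)
  also have "(\<Sum>a\<in>(Basis::'a set). \<Sum>b\<in>Basis. (x \<bullet> b) * ?d b) = ?n * (real m * p x)"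
    by (simp add: e)
  finally show ?thesis
    unfolding homogeneous_euler2[OF assms] diag by (simp add: algebra_simps)
qed

text \<open>
  The angular Laplacian is self-adjoint. It multiplies \<open>p\<close> by an eigenvalue, and it multiplies
  \<open>q\<close> by a different one up to \<open>laplacian q\<close>, whose terms have lower degree.
\<close>

lemma sphere_integral_harmonic_lower_degree:
  fixes p q :: "'a::euclidean_space \<Rightarrow> real"
  assumes p: "homogeneous_harmonic_polynomial l p" and q: "homogeneous m q" and "m < l"
    and dim: "DIM('a) \<ge> 2"
  shows "sphere_integral (\<lambda>x. p x * q x) = 0"
  using q \<open>m < l\<close>
proof (induction m arbitrary: q rule: less_induct)
  case (less m)
  note q = homogeneous_polynomial[OF less.prems(1)]
  have hp: "homogeneous l p" and lap0: "\<And>x. laplacian p x = 0"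
    using p by (auto simp: homogeneous_def homogeneous_harmonic_polynomial_def)
  note pp = homogeneous_polynomial[OF hp]
  let ?e = "\<lambda>k::nat. real k * (real k + real DIM('a) - 2)"
  have lap: "real_polynomial_function (laplacian q)"
    unfolding laplacian_eq_sum_partial_deriv[OF q, abs_def]
    by (intro real_polynomial_function_sum real_polynomial_function_partial_deriv q) auto
  have z: "sphere_integral (\<lambda>x. p x * laplacian q x) = 0"
  \<comment> \<open>Below degree 2 all second derivatives vanish; otherwise they are homogeneous of
    degree \<open>m - 2\<close> and fall under the induction hypothesis.\<close>
  proof (cases "m < 2")
    case True
    then have "partial_deriv b (partial_deriv b q) = (\<lambda>x. 0)" for b
      using less.prems(1) homogeneous_partial_deriv[of 0 q b]
      by (cases "m = 0") (auto simp: homogeneous_0_partial_deriv less_2_cases_iff)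
    then have "laplacian q x = 0" for x
      by (simp add: laplacian_eq_sum_partial_deriv[OF q])
    then show ?thesis by simp
  next
    case False
    then obtain k where k: "m = Suc (Suc k)" by (metis add_2_eq_Suc le_Suc_ex not_less)
    have "sphere_integral (\<lambda>x. p x * partial_deriv b (partial_deriv b q) x) = 0" for b
      using less.prems k by (intro less.IH[of k] homogeneous_partial_deriv) auto
    moreover have "sphere_integral (\<lambda>x. p x * laplacian q x)
      = (\<Sum>b\<in>Basis. sphere_integral (\<lambda>x. p x * partial_deriv b (partial_deriv b q) x))"
      unfolding laplacian_eq_sum_partial_deriv[OF q] sum_distrib_left
      by (intro sphere_integral_sum continuous_real_polynomial_function
          real_polynomial_function.intros(4) real_polynomial_function_partial_deriv pp q)
    ultimately show ?thesis by simp
  qed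
  note cont = continuous_real_polynomial_function[OF real_polynomial_function.intros(4)]
  have "sphere_integral (\<lambda>x. p x * angular_laplacian q x)
      = sphere_integral (\<lambda>x. 2 * (p x * laplacian q x) - 2 * ?e m * (p x * q x))"
    by (rule sphere_integral_cong) (simp add: angular_laplacian_homogeneous[OF less.prems(1)] algebra_simps)
  also have "\<dots> = - (2 * ?e m * sphere_integral (\<lambda>x. p x * q x))"
    by (subst sphere_integral_diff)
       (auto intro!: continuous_intros cont pp q lap simp: sphere_integral_cmult z)
  finally have 1: "sphere_integral (\<lambda>x. p x * angular_laplacian q x)
      = - (2 * ?e m * sphere_integral (\<lambda>x. p x * q x))" .
  have "sphere_integral (\<lambda>x. q x * angular_laplacian p x)
      = sphere_integral (\<lambda>x. - (2 * ?e l) * (p x * q x))"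
    by (rule sphere_integral_cong) (simp add: angular_laplacian_homogeneous[OF hp] lap0 algebra_simps)
  also have "\<dots> = - (2 * ?e l) * sphere_integral (\<lambda>x. p x * q x)"
    by (rule sphere_integral_cmult)
  finally have "?e m * sphere_integral (\<lambda>x. p x * q x) = ?e l * sphere_integral (\<lambda>x. p x * q x)"
    using 1 sphere_integral_angular_laplacian_commute[OF pp q] by auto
  \<comment> \<open>Distinct eigenvalues force the integral to be 0. In dimension 1 the degrees 0
    and 1 would share the eigenvalue 0.\<close>
  moreover have "?e m < ?e l"
    using less.prems(2) dim by (intro mult_strict_mono') auto
  ultimately show ?case by auto
qed

section \<open>Orthonormal systems of homogeneous polynomials\<close>

text \<open>Generation from coordinates gives access to products, linear substitutions and finite
  generating sets by rule induction; \<open>form_homogeneous\<close> leads back to the calculus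
  above.\<close>

inductive form :: "nat \<Rightarrow> ('a::euclidean_space \<Rightarrow> real) \<Rightarrow> bool" where
  form_const: "form 0 (\<lambda>x. c)"
| form_coord: "b \<in> Basis \<Longrightarrow> form n p \<Longrightarrow> form (Suc n) (\<lambda>x. (x \<bullet> b) * p x)"
| form_add: "form n p \<Longrightarrow> form n q \<Longrightarrow> form n (\<lambda>x. p x + q x)"

lemma form_zero: "form n (\<lambda>x::'a::euclidean_space. 0)"
proof (induction n)
  case (Suc n)
  obtain b :: 'a where "b \<in> Basis" using nonempty_Basis by blast
  from form_coord[OF this Suc] show ?case by simp
qed (rule form_const)

lemma form_cmult: "form n p \<Longrightarrow> form n (\<lambda>x. c * p x)"
proof (induction rule: form.induct)
  case (form_coord b n p)
  from form.form_coord[OF form_coord(1,3)] show ?case by (simp add: mult_ac)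
next
  case (form_add n p q)
  from form.form_add[OF form_add(3,4)] show ?case by (simp add: algebra_simps)
qed (rule form_const)

lemma form_sum:
  assumes "\<And>i. i \<in> I \<Longrightarrow> form n (p i)"
  shows "form n (\<lambda>x. \<Sum>i\<in>I. p i x)"
  using assms
proof (induction I rule: infinite_finite_induct)
  case (insert i I)
  then show ?case using form_add[of n "p i" "\<lambda>x. \<Sum>i\<in>I. p i x"] by simp
qed (auto simp: form_zero)

lemma form_lincomb:
  "(\<And>i. i \<in> I \<Longrightarrow> form n (p i)) \<Longrightarrow> form n (\<lambda>x. \<Sum>i\<in>I. c i * p i x)"
  by (intro form_sum form_cmult)

lemma form_mult: "form m p \<Longrightarrow> form n q \<Longrightarrow> form (m + n) (\<lambda>x. p x * q x)"
proof (induction rule: form.induct)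
  case (form_const c)
  then show ?case by (simp add: form_cmult)
next
  case (form_coord b n p)
  from form.form_coord[OF form_coord(1) form_coord(3)[OF form_coord(4)]]
  show ?case by (simp add: mult_ac)
next
  case (form_add n p q)
  from form.form_add[OF form_add(3)[OF form_add(5)] form_add(4)[OF form_add(5)]]
  show ?case by (simp add: algebra_simps)
qed

lemma form_prod:
  assumes "finite I" "\<And>i. i \<in> I \<Longrightarrow> form (n i) (p i)"
  shows "form (\<Sum>i\<in>I. n i) (\<lambda>x. \<Prod>i\<in>I. p i x)"
  using assms
proof (induction I rule: finite_induct)
  case (insert i I)
  then show ?case using form_mult[of "n i" "p i" "\<Sum>i\<in>I. n i" "\<lambda>x. \<Prod>i\<in>I. p i x"] by simp
qed (simp add: form_const)

lemma form_inner: "form 1 (\<lambda>x. x \<bullet> v)"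
proof -
  have "form 1 (\<lambda>x. \<Sum>b\<in>Basis. (v \<bullet> b) * ((x \<bullet> b) * 1))"
    using form_coord[OF _ form_const[of 1]] by (intro form_lincomb) simp
  then show ?thesis by (subst euclidean_inner) (simp add: mult.commute)
qed

text \<open>The source of the rotation invariance of the space of forms: a coordinate of
  \<open>R x\<close> is the linear form \<open>x \<bullet> adjoint R b\<close>.\<close>

lemma form_compose_linear:
  fixes R :: "'a::euclidean_space \<Rightarrow> 'a"
  assumes "linear R"
  shows "form n p \<Longrightarrow> form n (\<lambda>x. p (R x))"
proof (induction rule: form.induct)
  case (form_coord b n p)
  have "R x \<bullet> b = x \<bullet> adjoint R b" for x
    by (rule adjoint_works[OF assms, symmetric])
  then show ?case
    using form_mult[OF form_inner[of "adjoint R b"] form_coord(3)] by simp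
qed (auto intro: form.intros)

lemma form_homogeneous: "form n p \<Longrightarrow> homogeneous n p"
proof (induction rule: form.induct)
  case (form_coord b n p)
  then show ?case
    by (auto simp: homogeneous_def intro!: real_polynomial_function.intros(4) real_polynomial_function_inner)
qed (auto simp: homogeneous_def algebra_simps intro: real_polynomial_function.intros)

lemma form_continuous: "form n p \<Longrightarrow> continuous_on S p"
  by (rule homogeneous_continuous[OF form_homogeneous])

definition closed_lincomb :: "('a \<Rightarrow> real) set \<Rightarrow> bool" where
  "closed_lincomb W \<longleftrightarrow> (\<forall>p\<in>W. \<forall>q\<in>W. (\<lambda>x. p x + q x) \<in> W) \<and> (\<forall>c. \<forall>p\<in>W. (\<lambda>x. c * p x) \<in> W)"

lemma
  assumes "closed_lincomb W" "p \<in> W"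
  shows closed_lincomb_add: "q \<in> W \<Longrightarrow> (\<lambda>x. p x + q x) \<in> W"
    and closed_lincomb_cmult: "(\<lambda>x. c * p x) \<in> W"
  using assms by (auto simp: closed_lincomb_def)

text \<open>
  Real functions are no instance of the class of vector spaces, hence the span of \<open>G\<close> is
  described by the closed sets containing it.
\<close>

lemma form_finite_span:
  "\<exists>G :: ('a::euclidean_space \<Rightarrow> real) set. finite G \<and> (\<forall>g\<in>G. form n g) \<and>
    (\<forall>W. closed_lincomb W \<longrightarrow> G \<subseteq> W \<longrightarrow> {p. form n p} \<subseteq> W)"
proof (induction n)
  case 0
  have "p \<in> W" if "form 0 p" and W: "closed_lincomb W" and G: "{\<lambda>x. 1} \<subseteq> W"
    for p and W :: "('a \<Rightarrow> real) set"
    using \<open>form 0 p\<close>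
  proof (induction "0::nat" p rule: form.induct)
    case (form_const c)
    show ?case using closed_lincomb_cmult[OF W, of "\<lambda>x. 1" c] G by simp
  next
    case (form_add p q)
    then show ?case using closed_lincomb_add[OF W] by blast
  qed
  then have "\<forall>W :: ('a \<Rightarrow> real) set. closed_lincomb W \<longrightarrow> {\<lambda>x. 1} \<subseteq> W \<longrightarrow> {p. form 0 p} \<subseteq> W"
    by blast
  then show ?case using form_const by (intro exI[of _ "{\<lambda>x. 1}"]) blast
next
  case (Suc n)
  then obtain G :: "('a \<Rightarrow> real) set" where G: "finite G" "\<And>g. g \<in> G \<Longrightarrow> form n g"
    and span: "\<And>W. closed_lincomb W \<Longrightarrow> G \<subseteq> W \<Longrightarrow> {p. form n p} \<subseteq> W"
    by blast
  define G' where "G' = (\<lambda>(b, g) x. (x \<bullet> b) * g x) ` (Basis \<times> G)"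
  have "p \<in> W" if "form (Suc n) p" and W: "closed_lincomb W" and GW: "G' \<subseteq> W"
    for p and W :: "('a \<Rightarrow> real) set"
    using \<open>form (Suc n) p\<close>
  proof (induction "Suc n" p rule: form.induct)
    case (form_coord b p)
    \<comment> \<open>Multiplication by a coordinate is linear, so the functions that it carries
      into \<open>W\<close> form a closed set, and the spanning property in degree \<open>n\<close>
      applies to it.\<close>
    define V where "V = {q. (\<lambda>x. (x \<bullet> b) * q x) \<in> W}"
    have "closed_lincomb V"
      unfolding closed_lincomb_def
    proof (intro conjI ballI allI)
      fix q r assume "q \<in> V" "r \<in> V"
      with closed_lincomb_add[OF W, of "\<lambda>x. (x \<bullet> b) * q x" "\<lambda>x. (x \<bullet> b) * r x"]
      show "(\<lambda>x. q x + r x) \<in> V" by (simp add: V_def algebra_simps)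
    next
      fix c q assume "q \<in> V"
      with closed_lincomb_cmult[OF W, of "\<lambda>x. (x \<bullet> b) * q x" c]
      show "(\<lambda>x. c * q x) \<in> V" by (simp add: V_def mult_ac)
    qed
    moreover have "G \<subseteq> V"
      using GW form_coord(1) by (auto simp: V_def G'_def image_subset_iff)
    ultimately have "p \<in> V" using span form_coord by blast
    then show ?case by (simp add: V_def)
  next
    case (form_add p q)
    then show ?case using closed_lincomb_add[OF W] by blast
  qed
  then have "\<forall>W. closed_lincomb W \<longrightarrow> G' \<subseteq> W \<longrightarrow> {p. form (Suc n) p} \<subseteq> W" by blast
  moreover have "finite G'" "\<forall>g\<in>G'. form (Suc n) g"
    using G by (auto simp: G'_def intro: form_coord)
  ultimately show ?case by blast
qed

section \<open>Orthonormal systems on the sphere and Gram-Schmidt\<close>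

definition orthonormal_system :: "nat \<Rightarrow> (nat \<Rightarrow> 'a::euclidean_space \<Rightarrow> real) \<Rightarrow> bool" where
  "orthonormal_system D \<phi> \<longleftrightarrow> (\<forall>j<D. continuous_on UNIV (\<phi> j)) \<and>
     (\<forall>i<D. \<forall>j<D. sphere_integral (\<lambda>x. \<phi> i x * \<phi> j x) = (if i = j then 1 else 0))"

lemma orthonormal_system_lincomb:
  fixes \<phi> :: "nat \<Rightarrow> 'a::euclidean_space \<Rightarrow> real"
  assumes "orthonormal_system D \<phi>"
  shows "sphere_integral (\<lambda>x. (\<Sum>i<D. a i * \<phi> i x) * (\<Sum>j<D. b j * \<phi> j x)) = (\<Sum>i<D. a i * b i)"
proof -
  have c: "\<And>j. j < D \<Longrightarrow> continuous_on UNIV (\<phi> j)"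
    and o: "\<And>i j. i < D \<Longrightarrow> j < D \<Longrightarrow> sphere_integral (\<lambda>x. \<phi> i x * \<phi> j x) = (if i = j then 1 else 0)"
    using assms by (auto simp: orthonormal_system_def)
  have "sphere_integral (\<lambda>x. (\<Sum>i<D. a i * \<phi> i x) * (\<Sum>j<D. b j * \<phi> j x))
    = sphere_integral (\<lambda>x. \<Sum>i<D. \<Sum>j<D. (a i * b j) * (\<phi> i x * \<phi> j x))"
    by (simp add: sum_product mult_ac)
  also have "\<dots> = (\<Sum>i<D. sphere_integral (\<lambda>x. \<Sum>j<D. (a i * b j) * (\<phi> i x * \<phi> j x)))"
    by (intro sphere_integral_sum continuous_intros c) auto
  also have "\<dots> = (\<Sum>i<D. \<Sum>j<D. sphere_integral (\<lambda>x. (a i * b j) * (\<phi> i x * \<phi> j x)))"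
    by (intro sum.cong refl sphere_integral_sum continuous_intros c) auto
  also have "\<dots> = (\<Sum>i<D. \<Sum>j<D. if i = j then a i * b j else 0)"
    by (intro sum.cong refl) (simp add: sphere_integral_cmult o del: mult.assoc)
  also have "\<dots> = (\<Sum>i<D. a i * b i)" by simp
  finally show ?thesis .
qed

lemma orthonormal_system_lincomb_coeff:
  fixes \<phi> :: "nat \<Rightarrow> 'a::euclidean_space \<Rightarrow> real"
  assumes "orthonormal_system D \<phi>" "k < D"
  shows "sphere_integral (\<lambda>x. (\<Sum>i<D. a i * \<phi> i x) * \<phi> k x) = a k"
proof -
  have "(\<Sum>j<D. (if j = k then 1 else 0) * \<phi> j x) = \<phi> k x" for x
    using assms(2) by (simp add: if_distrib[of "\<lambda>c. c * _"] cong: if_cong)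
  then show ?thesis
    using orthonormal_system_lincomb[OF assms(1), of a "\<lambda>j. if j = k then 1 else 0"] assms(2)
    by (simp add: if_distrib cong: if_cong)
qed

text \<open>The normalising step of Gram-Schmidt. That \<open>s\<close> is nonzero is recorded so
  that \<open>r\<close> can be recovered from the extended system.\<close>

lemma orthonormal_system_extend:
  fixes \<phi> :: "nat \<Rightarrow> 'a::euclidean_space \<Rightarrow> real"
  assumes \<phi>: "orthonormal_system D \<phi>" and r: "continuous_on UNIV r"
    and perp: "\<And>j. j < D \<Longrightarrow> sphere_integral (\<lambda>x. r x * \<phi> j x) = 0"
    and y: "y \<in> sphere 0 1" "r y \<noteq> 0"
  obtains s where "s \<noteq> 0" "orthonormal_system (Suc D) (\<phi>(D := \<lambda>x. s * r x))"
proof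
  let ?n = "sphere_integral (\<lambda>x. (r x)\<^sup>2)"
  let ?s = "1 / sqrt ?n"
  have pos: "?n > 0" by (rule sphere_integral_power2_pos[OF r y])
  then show "?s \<noteq> 0" by simp
  have "sphere_integral (\<lambda>x. (?s * r x) * (?s * r x)) = sphere_integral (\<lambda>x. (?s * ?s) * (r x)\<^sup>2)"
    by (simp add: power2_eq_square mult_ac)
  also have "\<dots> = 1"
    using pos by (subst sphere_integral_cmult) simp
  finally have 1: "sphere_integral (\<lambda>x. (?s * r x) * (?s * r x)) = 1" .
  have 2: "sphere_integral (\<lambda>x. (?s * r x) * \<phi> j x) = 0"
    "sphere_integral (\<lambda>x. \<phi> j x * (?s * r x)) = 0" if "j < D" for j
    using perp[OF that] sphere_integral_cmult[of ?s "\<lambda>x. r x * \<phi> j x"] by (simp_all add: mult_ac)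
  show "orthonormal_system (Suc D) (\<phi>(D := \<lambda>x. ?s * r x))"
    using \<phi> r 1 2 unfolding orthonormal_system_def
    by (auto simp: less_Suc_eq intro!: continuous_intros simp del: times_divide_eq_left)
qed

lemma gram_schmidt_remainder:
  fixes \<phi> :: "nat \<Rightarrow> 'a::euclidean_space \<Rightarrow> real"
  assumes \<phi>: "orthonormal_system D \<phi>" and g: "continuous_on UNIV g" and "k < D"
  shows "sphere_integral (\<lambda>x. (g x - (\<Sum>j<D. sphere_integral (\<lambda>x. g x * \<phi> j x) * \<phi> j x)) * \<phi> k x) = 0"
proof -
  have c: "\<And>j. j < D \<Longrightarrow> continuous_on UNIV (\<phi> j)"
    using \<phi> by (auto simp: orthonormal_system_def)
  let ?c = "\<lambda>j. sphere_integral (\<lambda>x. g x * \<phi> j x)"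
  have "sphere_integral (\<lambda>x. (g x - (\<Sum>j<D. ?c j * \<phi> j x)) * \<phi> k x)
    = sphere_integral (\<lambda>x. g x * \<phi> k x - (\<Sum>j<D. ?c j * \<phi> j x) * \<phi> k x)"
    by (simp add: left_diff_distrib)
  also have "\<dots> = ?c k - sphere_integral (\<lambda>x. (\<Sum>j<D. ?c j * \<phi> j x) * \<phi> k x)"
    by (intro sphere_integral_diff continuous_intros g c) (use \<open>k < D\<close> in auto)
  also have "\<dots> = 0"
    by (simp add: orthonormal_system_lincomb_coeff[OF \<phi> \<open>k < D\<close>])
  finally show ?thesis .
qed

text \<open>Bounds the dimension of the space of forms from below. The functions already built
  vanish at all points not yet treated, so the Gram-Schmidt remainder at the next point keeps the
  nonzero value of \<open>p i\<close> there and never degenerates.\<close>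

lemma orthonormal_system_of_interpolation:
  fixes p :: "'i \<Rightarrow> 'a::euclidean_space \<Rightarrow> real" and y :: "'i \<Rightarrow> 'a"
  assumes "finite A" and p: "\<And>i. i \<in> A \<Longrightarrow> form n (p i)" and y: "\<And>i. i \<in> A \<Longrightarrow> y i \<in> sphere 0 1"
    and py: "\<And>i j. i \<in> A \<Longrightarrow> j \<in> A \<Longrightarrow> p i (y j) \<noteq> 0 \<longleftrightarrow> i = j"
  shows "\<exists>\<phi> :: nat \<Rightarrow> 'a \<Rightarrow> real. orthonormal_system (card A) \<phi> \<and> (\<forall>j<card A. form n (\<phi> j))"
proof -
  have "B \<subseteq> A \<Longrightarrow> \<exists>\<phi>. orthonormal_system (card B) \<phi> \<and>
     (\<forall>j<card B. form n (\<phi> j) \<and> (\<forall>i\<in>A - B. \<phi> j (y i) = 0))" if "finite B" for B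
    using that
  proof (induction B rule: finite_induct)
    case empty
    show ?case by (auto simp: orthonormal_system_def)
  next
    case (insert i B)
    let ?D = "card B"
    obtain \<phi> where \<phi>: "orthonormal_system ?D \<phi>" and f: "\<And>j. j < ?D \<Longrightarrow> form n (\<phi> j)"
      and v: "\<And>j k. j < ?D \<Longrightarrow> k \<in> A \<Longrightarrow> k \<notin> B \<Longrightarrow> \<phi> j (y k) = 0"
      using insert by auto
    have i: "i \<in> A" "i \<notin> B" using insert by auto
    define r where "r = (\<lambda>x. p i x - (\<Sum>j<?D. sphere_integral (\<lambda>x. p i x * \<phi> j x) * \<phi> j x))"
    have fr: "form n r"
      using form_add[OF p[OF i(1)] form_lincomb[of "{..<?D}" n \<phi> "\<lambda>j. - sphere_integral (\<lambda>x. p i x * \<phi> j x)"]] f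
      by (simp add: r_def sum_negf)
    have ry: "r (y k) = p i (y k)" if "k \<in> A" "k \<notin> B" for k
      using v that by (simp add: r_def)
    have "sphere_integral (\<lambda>x. r x * \<phi> j x) = 0" if "j < ?D" for j
      unfolding r_def by (rule gram_schmidt_remainder[OF \<phi> form_continuous[OF p[OF i(1)]] that])
    from orthonormal_system_extend[OF \<phi> form_continuous[OF fr] this y[OF i(1)]]
    obtain s where s: "orthonormal_system (Suc ?D) (\<phi>(?D := \<lambda>x. s * r x))"
      using ry[OF i] py[OF i(1) i(1)] by auto
    have "form n ((\<phi>(?D := \<lambda>x. s * r x)) j) \<and> (\<forall>k\<in>A - insert i B. (\<phi>(?D := \<lambda>x. s * r x)) j (y k) = 0)"
      if "j < Suc ?D" for j
      using that f v form_cmult[OF fr, of s] ry py[OF i(1)] by (auto simp: less_Suc_eq)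
    with s insert(1,2) show ?case
      by (intro exI[of _ "\<phi>(?D := \<lambda>x. s * r x)"]) (simp del: fun_upd_apply)
  qed
  from this[OF assms(1)] show ?thesis by auto
qed

section \<open>Extension to a basis of all forms, and the kernel on the diagonal\<close>

definition sphere_span :: "nat \<Rightarrow> (nat \<Rightarrow> 'a::euclidean_space \<Rightarrow> real) \<Rightarrow> ('a \<Rightarrow> real) set" where
  "sphere_span D \<phi> = {p. \<exists>c. \<forall>x\<in>sphere 0 1. p x = (\<Sum>j<D. c j * \<phi> j x)}"

text \<open>Starting from a given system preserves the lower bound on the size, while running
  through generators makes the span exhaustive. A generator whose remainder vanishes on the sphere
  adds nothing, even if it is a new polynomial.\<close>

lemma orthonormal_system_complete:
  fixes \<phi> :: "nat \<Rightarrow> 'a::euclidean_space \<Rightarrow> real" and G :: "('a \<Rightarrow> real) set"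
  assumes "finite G" "\<And>g. g \<in> G \<Longrightarrow> form n g"
    and "orthonormal_system D \<phi>" "\<And>j. j < D \<Longrightarrow> form n (\<phi> j)"
  shows "\<exists>D' \<phi>'. D \<le> D' \<and> orthonormal_system D' \<phi>' \<and> (\<forall>j<D'. form n (\<phi>' j)) \<and> G \<subseteq> sphere_span D' \<phi>'"
  using assms(1,2)
proof (induction G rule: finite_induct)
  case empty
  show ?case using assms(3,4) by (intro exI[of _ D] exI[of _ \<phi>]) auto
next
  case (insert g G)
  then obtain E \<psi> where \<psi>: "D \<le> E" "orthonormal_system E \<psi>" and f: "\<And>j. j < E \<Longrightarrow> form n (\<psi> j)"
    and G: "G \<subseteq> sphere_span E \<psi>" by auto
  have fg: "form n g" using insert by simp
  let ?c = "\<lambda>j. sphere_integral (\<lambda>x. g x * \<psi> j x)"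
  define r where "r = (\<lambda>x. g x - (\<Sum>j<E. ?c j * \<psi> j x))"
  show ?case
  proof (cases "\<forall>x\<in>sphere 0 1. r x = 0")
    case True
    then have "g \<in> sphere_span E \<psi>" by (auto simp: sphere_span_def r_def intro!: exI[of _ ?c])
    with \<psi> f G show ?thesis by blast
  next
    case False
    then obtain y where y: "y \<in> sphere 0 1" "r y \<noteq> 0" by blast
    have fr: "form n r"
      using form_add[OF fg form_lincomb[of "{..<E}" n \<psi> "\<lambda>j. - ?c j"]] f
      by (simp add: r_def sum_negf)
    have "sphere_integral (\<lambda>x. r x * \<psi> j x) = 0" if "j < E" for j
      unfolding r_def by (rule gram_schmidt_remainder[OF \<psi>(2) form_continuous[OF fg] that])
    from orthonormal_system_extend[OF \<psi>(2) form_continuous[OF fr] this y]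
    obtain s where s: "s \<noteq> 0" "orthonormal_system (Suc E) (\<psi>(E := \<lambda>x. s * r x))" by blast
    let ?\<psi> = "\<psi>(E := \<lambda>x. s * r x)"
    \<comment> \<open>The coefficient \<open>1 / s\<close> undoes the normalisation of the
      remainder.\<close>
    have "g \<in> sphere_span (Suc E) ?\<psi>"
      using s(1) by (auto simp: sphere_span_def r_def intro!: exI[of _ "?c(E := 1 / s)"])
    moreover have "G \<subseteq> sphere_span (Suc E) ?\<psi>"
    proof
      fix h assume "h \<in> G"
      then obtain c where "\<forall>x\<in>sphere 0 1. h x = (\<Sum>j<E. c j * \<psi> j x)"
        using G by (auto simp: sphere_span_def)
      then show "h \<in> sphere_span (Suc E) ?\<psi>"
        by (auto simp: sphere_span_def intro!: exI[of _ "c(E := 0)"])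
    qed
    moreover have "\<forall>j<Suc E. form n (?\<psi> j)"
      using f form_cmult[OF fr] by (auto simp: less_Suc_eq)
    ultimately show ?thesis using s \<psi>(1)
      by (intro exI[of _ "Suc E"] exI[of _ ?\<psi>]) (simp del: fun_upd_apply)
  qed
qed

text \<open>The reflection in the hyperplane orthogonal to \<open>a - b\<close> exchanges two
  vectors of equal norm.\<close>

lemma orthogonal_transformation_transitive:
  fixes a b :: "'a::euclidean_space"
  assumes "norm a = norm b"
  obtains R where "orthogonal_transformation R" "R a = b"
proof (cases "a = b")
  case True
  then show ?thesis using that[of "\<lambda>x. x"] by simp
next
  case False
  define u where "u = a - b"
  define k where "k = 2 / (u \<bullet> u)"
  define R where "R = (\<lambda>x. x - (k * (x \<bullet> u)) *\<^sub>R u)"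
  have "u \<noteq> 0" using False by (simp add: u_def)
  then have k: "k * (u \<bullet> u) = 2" by (simp add: k_def)
  have "linear R"
    by (rule linearI) (simp_all add: R_def inner_add_left algebra_simps)
  moreover have "norm (R x) = norm x" for x
  proof -
    have "R x \<bullet> R x = x \<bullet> x + (k * (u \<bullet> u) - 2) * (k * (x \<bullet> u)\<^sup>2)"
      by (simp add: R_def inner_diff_left inner_diff_right inner_commute[of u x]
          power2_eq_square algebra_simps)
    then show ?thesis by (simp add: k norm_eq_sqrt_inner)
  qed
  ultimately have "orthogonal_transformation R" by (simp add: orthogonal_transformation)
  moreover have "R a = b"
  proof -
    have "a \<bullet> a = b \<bullet> b" using assms by (simp add: norm_eq_sqrt_inner)
    then have "2 * (a \<bullet> u) = u \<bullet> u" by (simp add: u_def inner_diff_left inner_diff_right inner_commute)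
    then have "k * (a \<bullet> u) = 1" using k by (metis mult.left_commute mult_cancel_left2 zero_neq_numeral)
    then show ?thesis by (simp add: R_def u_def)
  qed
  ultimately show ?thesis by (rule that)
qed

text \<open>
  The left-hand side is the diagonal of the reproducing kernel of the span, which is constant
  because the span is invariant under rotations.
\<close>

lemma orthonormal_system_kernel:
  fixes \<phi> :: "nat \<Rightarrow> 'a::euclidean_space \<Rightarrow> real"
  assumes \<phi>: "orthonormal_system D \<phi>" and f: "\<And>j. j < D \<Longrightarrow> form n (\<phi> j)"
    and span: "\<And>p. form n p \<Longrightarrow> p \<in> sphere_span D \<phi>" and x: "x \<in> sphere 0 1"
  shows "(\<Sum>j<D. (\<phi> j x)\<^sup>2) = real D"
proof -
  let ?K = "\<lambda>x. \<Sum>j<D. (\<phi> j x)\<^sup>2"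
  have le: "?K z \<le> ?K y" if y: "y \<in> sphere 0 1" "z \<in> sphere 0 1" for y z
  proof -
    obtain R where R: "orthogonal_transformation R" "R y = z"
      using orthogonal_transformation_transitive[of y z] y by auto
    \<comment> \<open>The kernel section at \<open>z\<close>, composed with \<open>R\<close>, lies
      in the span again. Rotation preserves its squared norm \<open>?K z\<close>, and its value at
      \<open>y\<close> is also \<open>?K z\<close>, so Cauchy-Schwarz compares the two
      diagonals.\<close>
    have "form n (\<lambda>w. \<Sum>j<D. \<phi> j z * \<phi> j (R w))"
      by (rule form_lincomb)
         (use f form_compose_linear[OF orthogonal_transformation_linear[OF R(1)]] in blast)
    from span[OF this] obtain c where
      c: "\<And>w. w \<in> sphere 0 1 \<Longrightarrow> (\<Sum>j<D. \<phi> j z * \<phi> j (R w)) = (\<Sum>j<D. c j * \<phi> j w)"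
      by (auto simp: sphere_span_def)
    let ?h = "\<lambda>w. (\<Sum>j<D. \<phi> j z * \<phi> j w) * (\<Sum>j<D. \<phi> j z * \<phi> j w)"
    have "(\<Sum>j<D. c j * c j) = sphere_integral (\<lambda>w. (\<Sum>j<D. c j * \<phi> j w) * (\<Sum>j<D. c j * \<phi> j w))"
      by (rule orthonormal_system_lincomb[OF \<phi>, symmetric])
    also have "\<dots> = sphere_integral (\<lambda>w. ?h (R w))"
      by (rule sphere_integral_cong) (simp only: c)
    also have "\<dots> = sphere_integral ?h"
      by (rule sphere_integral_orthogonal_transformation[OF R(1)])
         (auto intro!: continuous_intros form_continuous[OF f])
    also have "\<dots> = ?K z"
      using orthonormal_system_lincomb[OF \<phi>, of "\<lambda>j. \<phi> j z" "\<lambda>j. \<phi> j z"] by (simp add: power2_eq_square)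
    finally have cc: "(\<Sum>j<D. (c j)\<^sup>2) = ?K z" by (simp add: power2_eq_square)
    have "?K z = (\<Sum>j<D. c j * \<phi> j y)"
      using c[OF y(1)] by (simp add: R(2) power2_eq_square)
    then have "(?K z)\<^sup>2 \<le> (\<Sum>j<D. (c j)\<^sup>2) * ?K y"
      using Cauchy_Schwarz_ineq_sum[of c "\<lambda>j. \<phi> j y" "{..<D}"] by simp
    then have "?K z * ?K z \<le> ?K z * ?K y"
      by (simp only: cc power2_eq_square[of "?K z"])
    moreover have "0 \<le> ?K z" "0 \<le> ?K y" by (auto intro: sum_nonneg)
    ultimately show ?thesis by (cases "?K z = 0") (auto simp: mult_le_cancel_left)
  qed
  \<comment> \<open>A constant equals its mean, and orthonormality computes the mean of the
    diagonal.\<close>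
  have "?K x = sphere_integral (\<lambda>y::'a. ?K x)" by simp
  also have "\<dots> = sphere_integral ?K"
    by (rule sphere_integral_cong) (intro antisym le x, auto)
  also have "\<dots> = (\<Sum>j<D. sphere_integral (\<lambda>x. (\<phi> j x)\<^sup>2))"
    by (intro sphere_integral_sum continuous_intros form_continuous[OF f]) auto
  also have "\<dots> = real D"
    using \<phi> by (simp add: orthonormal_system_def power2_eq_square)
  finally show ?thesis .
qed

section \<open>The fooling function\<close>

text \<open>
  A Householder reflection turns the vector of values at \<open>x\<close> into a multiple of the last unit
  vector, so that all but the last of the reflected functions vanish at \<open>x\<close>.
\<close>

lemma orthonormal_system_vanish_at_point:
  fixes \<phi> :: "nat \<Rightarrow> 'a::euclidean_space \<Rightarrow> real"
  assumes \<phi>: "orthonormal_system (Suc m) \<phi>"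
  obtains \<psi> c where "orthonormal_system m \<psi>" "\<forall>j<m. \<psi> j = (\<lambda>y. \<Sum>i<Suc m. c j i * \<phi> i y)"
    "\<forall>j<m. \<psi> j x = 0" "\<forall>y. (\<Sum>j<m. (\<psi> j y)\<^sup>2) \<le> (\<Sum>i<Suc m. (\<phi> i y)\<^sup>2)"
proof -
  let ?I = "{..<Suc m}"
  define v where "v i = \<phi> i x" for i
  define r where "r = sqrt (\<Sum>i\<in>?I. (v i)\<^sup>2)"
  define u where "u i = v i - (if i = m then r else 0)" for i
  define s where "s = (\<Sum>i\<in>?I. (u i)\<^sup>2)"
  \<comment> \<open>For \<open>s = 0\<close> division by zero yields \<open>k = 0\<close>: the
    reflection degenerates to the identity, and \<open>kks\<close> still holds.\<close>
  define k where "k = 2 / s"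
  define U where "U y = (\<Sum>i\<in>?I. u i * \<phi> i y)" for y
  define \<psi> where "\<psi> j y = \<phi> j y - k * u j * U y" for j y
  define c where "c j i = (if i = j then 1 else 0) - k * u j * u i" for i j
  have r2: "r\<^sup>2 = (\<Sum>i\<in>?I. (v i)\<^sup>2)" by (simp add: r_def sum_nonneg)
  have kks: "k * (k * s) = 2 * k" by (simp add: k_def)
  have \<psi>_eq: "\<psi> j y = (\<Sum>i\<in>?I. c j i * \<phi> i y)" if "j \<in> ?I" for j y
    using that by (simp add: c_def \<psi>_def U_def left_diff_distrib sum_subtractf sum_distrib_left mult.assoc
        if_distrib[of "\<lambda>c. c * _"] del: sum.lessThan_Suc cong: if_cong)
  have cont: "continuous_on UNIV (\<phi> i)" if "i \<in> ?I" for i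
    using \<phi> that by (auto simp: orthonormal_system_def)
  have "sphere_integral (\<lambda>y. \<psi> i y * \<psi> j y) = (if i = j then 1 else 0)" if "i < m" "j < m" for i j
  proof -
    have "sphere_integral (\<lambda>y. \<psi> i y * \<psi> j y) = (\<Sum>l\<in>?I. c i l * c j l)"
      using that by (simp only: \<psi>_eq lessThan_iff less_SucI orthonormal_system_lincomb[OF \<phi>])
    also have "\<dots> = (\<Sum>l\<in>?I. (if l = i then (if i = j then 1 else 0) else 0)
        - (if l = i then k * u j * u i else 0) - (if l = j then k * u i * u j else 0) + k * k * u i * u j * (u l)\<^sup>2)"
      by (intro sum.cong refl) (auto simp: c_def power2_eq_square algebra_simps)
    also have "\<dots> = (if i = j then 1 else 0) - k * u j * u i - k * u i * u j + k * k * u i * u j * s"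
      using that by (simp add: sum.distrib sum_subtractf s_def sum_distrib_left del: sum.lessThan_Suc)
    also have "\<dots> = (if i = j then 1 else 0) + (k * (k * s) - 2 * k) * (u i * u j)"
      by (simp add: algebra_simps)
    finally show ?thesis by (simp add: kks)
  qed
  moreover have "continuous_on UNIV (\<psi> j)" if "j < m" for j
    unfolding \<psi>_def[abs_def] U_def by (intro continuous_intros cont) (use that in auto)
  ultimately have "orthonormal_system m \<psi>" by (simp add: orthonormal_system_def)
  moreover have "\<psi> j x = 0" if "j < m" for j
  proof (cases "s = 0")
    case True
    then have "u j = 0" using that by (simp add: s_def sum_nonneg_eq_0_iff del: sum.lessThan_Suc)
    then show ?thesis using that by (simp add: u_def \<psi>_def v_def)
  next
    case False
    \<comment> \<open>Both \<open>s / 2\<close> and \<open>U x\<close> equal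
      \<open>r\<^sup>2 - r * v m\<close>, so at \<open>x\<close> the reflection subtracts exactly
      \<open>u\<close>, which agrees with \<open>v\<close> outside the last place.\<close>
    have "s = (\<Sum>i\<in>?I. (v i)\<^sup>2 - (if i = m then 2 * r * v m - r\<^sup>2 else 0))"
      unfolding s_def by (intro sum.cong refl) (auto simp: u_def power2_eq_square algebra_simps)
    also have "\<dots> = 2 * (r\<^sup>2 - r * v m)"
      by (simp add: sum_subtractf r2[symmetric] del: sum.lessThan_Suc)
    finally have s: "s = 2 * (r\<^sup>2 - r * v m)" .
    have "U x = (\<Sum>i\<in>?I. (v i)\<^sup>2 - (if i = m then r * v m else 0))"
      unfolding U_def by (intro sum.cong refl) (auto simp: u_def v_def power2_eq_square algebra_simps)
    also have "\<dots> = r\<^sup>2 - r * v m"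
      by (simp add: sum_subtractf r2[symmetric] del: sum.lessThan_Suc)
    finally have "k * U x = 1" using s False by (simp add: k_def)
    then have "\<psi> j x = \<phi> j x - u j" by (simp add: \<psi>_def mult_ac)
    then show ?thesis using that by (simp add: u_def v_def)
  qed
  moreover have "(\<Sum>j<m. (\<psi> j y)\<^sup>2) \<le> (\<Sum>i\<in>?I. (\<phi> i y)\<^sup>2)" for y
  proof -
    \<comment> \<open>The full reflection preserves the sum of squares at every point; omitting the
      last function can only lower it.\<close>
    have "(\<Sum>j<m. (\<psi> j y)\<^sup>2) \<le> (\<Sum>j\<in>?I. (\<psi> j y)\<^sup>2)" by simp
    also have "\<dots> = (\<Sum>j\<in>?I. (\<phi> j y)\<^sup>2 - 2 * k * U y * (u j * \<phi> j y) + k * k * (U y)\<^sup>2 * (u j)\<^sup>2)"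
      by (simp add: \<psi>_def power2_eq_square algebra_simps)
    also have "\<dots> = (\<Sum>j\<in>?I. (\<phi> j y)\<^sup>2) - 2 * k * U y * U y + k * k * (U y)\<^sup>2 * s"
      by (simp add: sum.distrib sum_subtractf s_def U_def[of y] sum_distrib_left del: sum.lessThan_Suc)
    also have "\<dots> = (\<Sum>j\<in>?I. (\<phi> j y)\<^sup>2) + (k * (k * s) - 2 * k) * (U y)\<^sup>2"
      by (simp add: algebra_simps power2_eq_square del: sum.lessThan_Suc)
    finally show ?thesis by (simp add: kks)
  qed
  moreover have "\<psi> j = (\<lambda>y. \<Sum>i\<in>?I. c j i * \<phi> i y)" if "j < m" for j
    using that by (intro ext \<psi>_eq) simp
  ultimately show ?thesis using that[of \<psi> c] by blast
qed

text \<open>Each node costs one function. Zeros at earlier nodes survive because the new functions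
  are linear combinations of the old ones.\<close>

lemma orthonormal_system_vanish_at_points:
  fixes \<phi> :: "nat \<Rightarrow> 'a::euclidean_space \<Rightarrow> real"
  assumes \<phi>: "orthonormal_system D \<phi>" "\<And>j. j < D \<Longrightarrow> form n (\<phi> j)" and "N \<le> D"
  shows "\<exists>\<psi>. orthonormal_system (D - N) \<psi> \<and> (\<forall>j<D - N. form n (\<psi> j)) \<and>
    (\<forall>j<D - N. \<forall>i\<in>{1..N}. \<psi> j (x i) = 0) \<and> (\<forall>y. (\<Sum>j<D - N. (\<psi> j y)\<^sup>2) \<le> (\<Sum>i<D. (\<phi> i y)\<^sup>2))"
  using \<open>N \<le> D\<close>
proof (induction N)
  case 0
  show ?case using \<phi> by (intro exI[of _ \<phi>]) auto
next
  case (Suc N)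
  then obtain \<psi> where \<psi>: "orthonormal_system (D - N) \<psi>" "\<And>j. j < D - N \<Longrightarrow> form n (\<psi> j)"
    "\<And>j i. j < D - N \<Longrightarrow> i \<in> {1..N} \<Longrightarrow> \<psi> j (x i) = 0"
    "\<And>y. (\<Sum>j<D - N. (\<psi> j y)\<^sup>2) \<le> (\<Sum>i<D. (\<phi> i y)\<^sup>2)" by auto
  obtain m where m: "D - N = Suc m" "D - Suc N = m" using Suc.prems
    by (metis Suc_diff_le diff_Suc_Suc)
  obtain \<xi> c where \<xi>: "orthonormal_system m \<xi>"
    "\<forall>j<m. \<xi> j = (\<lambda>y. \<Sum>i<Suc m. c j i * \<psi> i y)"
    "\<forall>j<m. \<xi> j (x (Suc N)) = 0"
    "\<forall>y. (\<Sum>j<m. (\<xi> j y)\<^sup>2) \<le> (\<Sum>i<Suc m. (\<psi> i y)\<^sup>2)"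
    by (rule orthonormal_system_vanish_at_point[OF \<psi>(1)[unfolded m], of "x (Suc N)"])
  have "form n (\<xi> j)" if "j < m" for j
    unfolding \<xi>(2)[rule_format, OF that] using \<psi>(2) by (intro form_lincomb) (simp add: m)
  moreover have "\<xi> j (x i) = 0" if "j < m" "i \<in> {1..Suc N}" for i j
  proof (cases "i = Suc N")
    case False
    then show ?thesis
      unfolding \<xi>(2)[rule_format, OF that(1)] using that \<psi>(3) by (intro sum.neutral) (auto simp: m)
  qed (simp add: \<xi>(3)[rule_format, OF that(1)])
  moreover have "(\<Sum>j<m. (\<xi> j y)\<^sup>2) \<le> (\<Sum>i<D. (\<phi> i y)\<^sup>2)" for y
    using \<xi>(4)[rule_format, of y] \<psi>(4)[of y] unfolding m by linarith
  ultimately show ?case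
    unfolding m using \<xi>(1) by blast
qed

text \<open>
  Lagrange polynomials of the grid \<open>{0, \<dots>, k}\<^sup>d\<close>, homogenised by the coordinate \<open>e\<close> and evaluated
  at the central projections of the grid points to the sphere.
\<close>

lemma form_interpolation_grid:
  obtains A :: "('a::euclidean_space \<Rightarrow> nat) set" and p y where
    "finite A" "card A = (k + 1) ^ (DIM('a) - 1)"
    "\<forall>\<alpha>\<in>A. form (k * (DIM('a) - 1)) (p \<alpha>)" "\<forall>\<alpha>\<in>A. y \<alpha> \<in> sphere (0::'a) 1"
    "\<forall>\<alpha>\<in>A. \<forall>\<beta>\<in>A. p \<alpha> (y \<beta>) \<noteq> 0 \<longleftrightarrow> \<alpha> = \<beta>"
proof -
  obtain e :: 'a where e: "e \<in> Basis" using nonempty_Basis by blast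
  define B where "B = Basis - {e}"
  have B: "finite B" "card B = DIM('a) - 1" using e by (auto simp: B_def)
  define A where "A = (B \<rightarrow>\<^sub>E {..k})"
  \<comment> \<open>At \<open>z \<beta>\<close>, whose coordinate along \<open>e\<close> is 1, the
    factor equals \<open>\<beta> b - i\<close>. It is zero for some admissible \<open>i\<close>
    exactly when \<open>\<beta> b\<close> differs from \<open>\<alpha> b\<close>. Each
    \<open>b\<close> contributes \<open>k\<close> factors.\<close>
  define p where "p \<alpha> x = (\<Prod>b\<in>B. \<Prod>i\<in>{..k} - {\<alpha> b}. x \<bullet> (b - real i *\<^sub>R e))" for \<alpha> :: "'a \<Rightarrow> nat" and x
  define z where "z \<beta> = e + (\<Sum>b\<in>B. real (\<beta> b) *\<^sub>R b)" for \<beta> :: "'a \<Rightarrow> nat"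
  define y where "y \<beta> = z \<beta> /\<^sub>R norm (z \<beta>)" for \<beta>
  let ?L = "k * (DIM('a) - 1)"
  have A: "finite A" "card A = (k + 1) ^ (DIM('a) - 1)"
    using B by (auto simp: A_def card_PiE intro: finite_PiE)
  have fp: "form ?L (p \<alpha>)" if "\<alpha> \<in> A" for \<alpha>
  proof -
    have "form (\<Sum>b\<in>B. \<Sum>i\<in>{..k} - {\<alpha> b}. 1) (p \<alpha>)"
      unfolding p_def[abs_def] using B by (intro form_prod form_inner) auto
    moreover have "card ({..k} - {\<alpha> b}) = k" if "b \<in> B" for b
      using \<open>\<alpha> \<in> A\<close> that by (subst card_Diff_singleton) (auto simp: A_def)
    ultimately show ?thesis using B by (simp add: mult.commute)
  qed
  have ze: "z \<beta> \<bullet> e = 1" for \<beta>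
    using e by (auto simp: z_def inner_add_left inner_sum_left B_def inner_Basis intro!: sum.neutral)
  have zb: "z \<beta> \<bullet> b = real (\<beta> b)" if "b \<in> B" for b \<beta>
  proof -
    have "(\<Sum>c\<in>B. real (\<beta> c) * (c \<bullet> b)) = (\<Sum>c\<in>B. if c = b then real (\<beta> b) else 0)"
      using that by (intro sum.cong) (auto simp: B_def inner_Basis)
    then show ?thesis using that e B(1)
      by (auto simp: z_def inner_add_left inner_sum_left inner_Basis B_def)
  qed
  have nz: "norm (z \<beta>) \<noteq> 0" for \<beta>
    using ze[of \<beta>] by (metis inner_zero_left norm_eq_zero zero_neq_one)
  have y: "y \<alpha> \<in> sphere 0 1" for \<alpha>
    using nz[of \<alpha>] by (simp add: y_def)
  have py: "p \<alpha> (y \<beta>) \<noteq> 0 \<longleftrightarrow> \<alpha> = \<beta>" if "\<alpha> \<in> A" "\<beta> \<in> A" for \<alpha> \<beta>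
  proof -
    have "p \<alpha> (y \<beta>) = inverse (norm (z \<beta>)) ^ ?L * p \<alpha> (z \<beta>)"
      using form_homogeneous[OF fp[OF that(1)]] unfolding homogeneous_def y_def by blast
    then have "p \<alpha> (y \<beta>) \<noteq> 0 \<longleftrightarrow> p \<alpha> (z \<beta>) \<noteq> 0" using nz[of \<beta>] by simp
    also have "\<dots> \<longleftrightarrow> (\<forall>b\<in>B. \<forall>i\<in>{..k} - {\<alpha> b}. real (\<beta> b) \<noteq> real i)"
      using B(1) by (auto simp: p_def inner_diff_right ze zb)
    also have "\<dots> \<longleftrightarrow> (\<forall>b\<in>B. \<beta> b = \<alpha> b)"
      using that by (fastforce simp: A_def)
    also have "\<dots> \<longleftrightarrow> \<alpha> = \<beta>"
      using that PiE_ext[of \<alpha> B "\<lambda>_. {..k}" \<beta>] by (auto simp: A_def)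
    finally show ?thesis .
  qed
  show ?thesis using that[of A p y] A fp y py by blast
qed

text \<open>\<open>D\<close> is the dimension of the restricted forms. Maximum and mean are both
  measured against it, so its size drops out after scaling.\<close>

lemma fooling_function:
  fixes x :: "nat \<Rightarrow> 'a::euclidean_space"
  assumes "2 * N \<le> (k + 1) ^ (DIM('a) - 1)"
  shows "\<exists>f (D::nat). homogeneous (2 * (k * (DIM('a) - 1))) f \<and> (\<forall>i\<in>{1..N}. f (x i) = 0) \<and>
    (\<forall>y\<in>sphere 0 1. \<bar>f y\<bar> \<le> real D) \<and> D > 0 \<and> real D / 2 \<le> sphere_integral f"
proof -
  let ?L = "k * (DIM('a) - 1)" and ?M = "(k + 1) ^ (DIM('a) - 1)"
  obtain \<phi>\<^sub>0 :: "nat \<Rightarrow> 'a \<Rightarrow> real" where \<phi>\<^sub>0: "orthonormal_system ?M \<phi>\<^sub>0" "\<And>j. j < ?M \<Longrightarrow> form ?L (\<phi>\<^sub>0 j)"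
  proof -
    obtain A :: "('a \<Rightarrow> nat) set" and p y where A: "finite A" "card A = ?M"
      "\<forall>\<alpha>\<in>A. form ?L (p \<alpha>)" "\<forall>\<alpha>\<in>A. y \<alpha> \<in> sphere (0::'a) 1"
      "\<forall>\<alpha>\<in>A. \<forall>\<beta>\<in>A. p \<alpha> (y \<beta>) \<noteq> 0 \<longleftrightarrow> \<alpha> = \<beta>"
      by (rule form_interpolation_grid[of k, where 'a = 'a])
    then obtain \<phi> :: "nat \<Rightarrow> 'a \<Rightarrow> real" where
      "orthonormal_system (card A) \<phi>" "\<forall>j<card A. form ?L (\<phi> j)"
      using orthonormal_system_of_interpolation[OF A(1) A(3-5)[rule_format]] by blast
    then show ?thesis using that unfolding A(2) by blast
  qed
  obtain G :: "('a \<Rightarrow> real) set" where G: "finite G" "\<And>g. g \<in> G \<Longrightarrow> form ?L g"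
    "\<And>W. closed_lincomb W \<Longrightarrow> G \<subseteq> W \<Longrightarrow> {p. form ?L p} \<subseteq> W"
    using form_finite_span[of ?L, where 'a = 'a] by blast
  obtain D \<phi> where D: "?M \<le> D" and \<phi>: "orthonormal_system D \<phi>" "\<And>j. j < D \<Longrightarrow> form ?L (\<phi> j)"
    and span: "G \<subseteq> sphere_span D \<phi>"
    using orthonormal_system_complete[OF G(1,2) \<phi>\<^sub>0] by blast
  have "closed_lincomb (sphere_span D \<phi>)"
    unfolding closed_lincomb_def sphere_span_def
  proof (safe)
    fix p q a b assume "\<forall>x\<in>sphere 0 1. p x = (\<Sum>j<D. a j * \<phi> j x)" "\<forall>x\<in>sphere 0 1. q x = (\<Sum>j<D. b j * \<phi> j x)"
    then show "\<exists>c. \<forall>x\<in>sphere 0 1. p x + q x = (\<Sum>j<D. c j * \<phi> j x)"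
      by (intro exI[of _ "\<lambda>j. a j + b j"]) (simp add: distrib_right sum.distrib)
  next
    fix p a and c :: real assume "\<forall>x\<in>sphere 0 1. p x = (\<Sum>j<D. a j * \<phi> j x)"
    then show "\<exists>b. \<forall>x\<in>sphere 0 1. c * p x = (\<Sum>j<D. b j * \<phi> j x)"
      by (intro exI[of _ "\<lambda>j. c * a j"]) (simp add: sum_distrib_left mult_ac)
  qed
  with G(3) span have all: "\<And>p. form ?L p \<Longrightarrow> p \<in> sphere_span D \<phi>" by blast
  have ND: "2 * N \<le> D" using assms D by linarith
  obtain \<psi> where \<psi>: "orthonormal_system (D - N) \<psi>" "\<And>j. j < D - N \<Longrightarrow> form ?L (\<psi> j)"
    "\<And>j i. j < D - N \<Longrightarrow> i \<in> {1..N} \<Longrightarrow> \<psi> j (x i) = 0"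
    "\<And>y. (\<Sum>j<D - N. (\<psi> j y)\<^sup>2) \<le> (\<Sum>i<D. (\<phi> i y)\<^sup>2)"
    using orthonormal_system_vanish_at_points[OF \<phi>, of N x] ND by auto
  let ?f = "\<lambda>y. \<Sum>j<D - N. (\<psi> j y)\<^sup>2"
  have "form (?L + ?L) (\<lambda>y. \<Sum>j<D - N. \<psi> j y * \<psi> j y)"
    by (intro form_sum form_mult \<psi>(2)) auto
  then have "homogeneous (2 * ?L) ?f"
    by (simp add: form_homogeneous mult_2 power2_eq_square)
  moreover have "\<forall>i\<in>{1..N}. ?f (x i) = 0" using \<psi>(3) by simp
  moreover have "\<bar>?f y\<bar> \<le> real D" if "y \<in> sphere 0 1" for y
    using \<psi>(4)[of y] orthonormal_system_kernel[OF \<phi> all that] by (simp add: sum_nonneg)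
  moreover have "D > 0" using D by (metis gr0I le_zero_eq power_not_zero Suc_eq_plus1 nat.simps(3))
  moreover have "sphere_integral ?f = real (D - N)"
  proof -
    have "sphere_integral ?f = (\<Sum>j<D - N. sphere_integral (\<lambda>y. (\<psi> j y)\<^sup>2))"
      by (intro sphere_integral_sum continuous_intros form_continuous[OF \<psi>(2)]) auto
    then show ?thesis
      using \<psi>(1) by (simp add: orthonormal_system_def power2_eq_square)
  qed
  moreover have "real D / 2 \<le> real (D - N)" using ND by simp
  ultimately show ?thesis by (intro exI[of _ ?f] exI[of _ D]) auto
qed

section \<open>The lower bound\<close>

lemma sphere_bessel_inequality:
  fixes e :: "'i \<Rightarrow> 'a::euclidean_space \<Rightarrow> real"
  assumes "finite I" and f: "continuous_on UNIV f" and e: "\<And>i. i \<in> I \<Longrightarrow> continuous_on UNIV (e i)"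
    and orth: "\<And>i j. i \<in> I \<Longrightarrow> j \<in> I \<Longrightarrow> sphere_integral (\<lambda>x. e i x * e j x) = (if i = j then 1 else 0)"
  shows "(\<Sum>i\<in>I. (sphere_integral (\<lambda>x. f x * e i x))\<^sup>2) \<le> sphere_integral (\<lambda>x. (f x)\<^sup>2)"
proof -
  define c where "c i = sphere_integral (\<lambda>x. f x * e i x)" for i
  define g where "g x = (\<Sum>i\<in>I. c i * e i x)" for x
  have g: "continuous_on UNIV g"
    unfolding g_def[abs_def] by (intro continuous_intros e)
  have "sphere_integral (\<lambda>x. f x * g x) = sphere_integral (\<lambda>x. \<Sum>i\<in>I. c i * (f x * e i x))"
    by (simp add: g_def sum_distrib_left mult_ac)
  also have "\<dots> = (\<Sum>i\<in>I. c i * c i)"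
    by (subst sphere_integral_sum) (auto intro!: continuous_intros f e simp: sphere_integral_cmult c_def)
  finally have fg: "sphere_integral (\<lambda>x. f x * g x) = (\<Sum>i\<in>I. c i * c i)" .
  have "sphere_integral (\<lambda>x. g x * e j x) = c j" if j: "j \<in> I" for j
  proof -
    have "sphere_integral (\<lambda>x. g x * e j x) = sphere_integral (\<lambda>x. \<Sum>i\<in>I. c i * (e i x * e j x))"
      by (simp add: g_def sum_distrib_right mult.assoc)
    also have "\<dots> = (\<Sum>i\<in>I. c i * (if i = j then 1 else 0))"
      by (subst sphere_integral_sum)
         (use j in \<open>auto intro!: continuous_intros e sum.cong simp: sphere_integral_cmult orth\<close>)
    also have "\<dots> = c j" using \<open>finite I\<close> j by (simp add: if_distrib cong: if_cong)
    finally show ?thesis .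
  qed
  note ge = this
  have "sphere_integral (\<lambda>x. g x * g x) = sphere_integral (\<lambda>x. \<Sum>i\<in>I. c i * (g x * e i x))"
    by (simp add: g_def[of "_"] sum_distrib_left mult_ac)
  also have "\<dots> = (\<Sum>i\<in>I. c i * c i)"
    by (subst sphere_integral_sum) (auto intro!: continuous_intros g e sum.cong simp: sphere_integral_cmult ge)
  finally have gg: "sphere_integral (\<lambda>x. g x * g x) = (\<Sum>i\<in>I. c i * c i)" .
  have "0 \<le> sphere_integral (\<lambda>x. (f x - g x)\<^sup>2)"
    by (rule sphere_integral_nonneg) simp
  also have "\<dots> = sphere_integral (\<lambda>x. ((f x)\<^sup>2 - 2 * (f x * g x)) + g x * g x)"
    by (simp add: power2_eq_square algebra_simps)
  also have "\<dots> = (sphere_integral (\<lambda>x. (f x)\<^sup>2) - 2 * (\<Sum>i\<in>I. c i * c i)) + (\<Sum>i\<in>I. c i * c i)"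
    by (subst sphere_integral_add, (intro continuous_intros f g)+,
        subst sphere_integral_diff, (intro continuous_intros f g)+)
       (simp add: sphere_integral_cmult fg gg)
  finally show ?thesis by (simp add: c_def power2_eq_square)
qed

text \<open>The \<open>Y l k\<close> are prescribed on the sphere only; their polynomial
  representatives are continuous and homogeneous on the whole space.\<close>

lemma spherical_harmonic_basis_polynomials:
  fixes Y :: "nat \<Rightarrow> nat \<Rightarrow> 'a::euclidean_space \<Rightarrow> real"
  assumes "spherical_harmonic_basis Z Y"
  obtains P :: "nat \<Rightarrow> nat \<Rightarrow> 'a \<Rightarrow> real" where
    "\<And>l k. k \<in> {1..Z l} \<Longrightarrow> homogeneous_harmonic_polynomial l (P l k)"
    "\<And>l k x. k \<in> {1..Z l} \<Longrightarrow> x \<in> sphere 0 1 \<Longrightarrow> Y l k x = P l k x"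
proof -
  have "\<exists>p. homogeneous_harmonic_polynomial l p \<and> (\<forall>x\<in>sphere 0 1. Y l k x = p x)" if "k \<in> {1..Z l}" for l k
    using assms that unfolding spherical_harmonic_basis_def spherical_harmonics_def by blast
  then have "\<forall>l k. \<exists>p. k \<in> {1..Z l} \<longrightarrow> homogeneous_harmonic_polynomial l p \<and> (\<forall>x\<in>sphere 0 1. Y l k x = p x)"
    by blast
  then obtain P where "\<forall>l k. k \<in> {1..Z l} \<longrightarrow> homogeneous_harmonic_polynomial l (P l k) \<and>
      (\<forall>x\<in>sphere 0 1. Y l k x = P l k x)"
    by metis
  then show ?thesis using that[of P] by blast
qed

lemma eigval_nonneg: "d \<ge> 1 \<Longrightarrow> 0 \<le> eigval d l"
  unfolding eigval_def by (intro mult_nonneg_nonneg) auto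

lemma sobolev_weight_mono:
  assumes "d \<ge> 1" "\<gamma> > 0" "l \<le> m"
  shows "sobolev_weight d \<gamma> l \<le> sobolev_weight d \<gamma> m"
proof -
  have e: "0 \<le> eigval d l" "eigval d l \<le> eigval d m"
    using assms eigval_nonneg[of d l] by (auto simp: eigval_def intro!: mult_mono)
  show ?thesis
    unfolding sobolev_weight_def using e assms by (intro mult_mono powr_mono2) auto
qed

lemma sobolev_weight_pos:
  assumes "d \<ge> 1"
  shows "sobolev_weight d \<gamma> l > 0"
proof -
  show ?thesis using eigval_nonneg[OF assms, of l] by (auto simp: sobolev_weight_def intro!: mult_pos_pos)
qed

text \<open>Orthogonality to lower degrees cuts the series off after \<open>m\<close>. The remaining
  weights are at most the one at \<open>m\<close>, and Bessel's inequality bounds the unweighted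
  sum.\<close>

lemma homogeneous_sobolev:
  fixes f :: "'a::euclidean_space \<Rightarrow> real"
  assumes basis: "spherical_harmonic_basis Z Y" and "d \<ge> 1" "\<gamma> > 0" and dim: "DIM('a) \<ge> 2"
    and f: "homogeneous m f"
  shows "f \<in> sobolev_space d \<gamma> Z Y"
    and "sobolev_norm d \<gamma> Z Y f \<le> sqrt (sobolev_weight d \<gamma> m * sphere_integral (\<lambda>x. (f x)\<^sup>2))"
proof -
  obtain P where P: "\<And>l k. k \<in> {1..Z l} \<Longrightarrow> homogeneous_harmonic_polynomial l (P l k)"
    and YP: "\<And>l k x. k \<in> {1..Z l} \<Longrightarrow> x \<in> sphere 0 1 \<Longrightarrow> Y l k x = P l k x"
    using spherical_harmonic_basis_polynomials[OF basis] by blast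
  have hP: "homogeneous l (P l k)" if "k \<in> {1..Z l}" for l k
    using P[OF that] by (simp add: homogeneous_def homogeneous_harmonic_polynomial_def)
  note fc = homogeneous_continuous[OF f, of UNIV]
  have fourier: "fourier_coeff Y f l k = sphere_integral (\<lambda>x. f x * P l k x)" if "k \<in> {1..Z l}" for l k
    unfolding fourier_coeff_def by (rule sphere_integral_cong) (simp only: YP[OF that])
  have zero: "sobolev_term d \<gamma> Z Y f l = 0" if "l > m" for l
  proof -
    have "fourier_coeff Y f l k = 0" if "k \<in> {1..Z l}" for k
      using sphere_integral_harmonic_lower_degree[OF P[OF that] f \<open>l > m\<close> dim]
      by (simp add: fourier[OF that] mult.commute)
    then show ?thesis by (simp add: sobolev_term_def)
  qed
  have "f \<in> L2_sphere"
    unfolding L2_sphere_def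
    by (auto intro!: borel_measurable_sphere_measure borel_measurable_continuous_onI fc
        integrable_sphere_measure continuous_intros)
  moreover have "summable (sobolev_term d \<gamma> Z Y f)"
    by (rule summable_finite[of "{..m}"]) (use zero in auto)
  ultimately show "f \<in> sobolev_space d \<gamma> Z Y" by (simp add: sobolev_space_def)
  let ?I = "Sigma {..m} (\<lambda>l. {1..Z l})"
  \<comment> \<open>Within one degree this is the hypothesis on the basis; between degrees the
    harmonic of higher degree is orthogonal to the other one.\<close>
  have orth: "sphere_integral (\<lambda>x. P l k x * P l' k' x) = (if (l, k) = (l', k') then 1 else 0)"
    if k: "k \<in> {1..Z l}" "k' \<in> {1..Z l'}" for l k l' k'
  proof (cases l l' rule: linorder_cases)
    case less
    show ?thesis
      using sphere_integral_harmonic_lower_degree[OF P[OF k(2)] hP[OF k(1)] less dim] less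
      by (simp add: mult.commute)
  next
    case greater
    show ?thesis
      using sphere_integral_harmonic_lower_degree[OF P[OF k(1)] hP[OF k(2)] greater dim] greater by simp
  next
    case equal
    have "sphere_integral (\<lambda>x. P l k x * P l' k' x) = sphere_integral (\<lambda>x. Y l k x * Y l' k' x)"
      by (rule sphere_integral_cong) (simp only: YP k)
    then show ?thesis
      using basis k equal unfolding spherical_harmonic_basis_def by auto
  qed
  have "(\<Sum>l. sobolev_term d \<gamma> Z Y f l) = (\<Sum>l\<le>m. sobolev_term d \<gamma> Z Y f l)"
    by (rule suminf_finite) (use zero in auto)
  also have "\<dots> \<le> (\<Sum>l\<le>m. sobolev_weight d \<gamma> m * (\<Sum>k=1..Z l. \<bar>fourier_coeff Y f l k\<bar>\<^sup>2))"
    unfolding sobolev_term_def using assms(2,3)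
    by (intro sum_mono mult_right_mono sobolev_weight_mono sum_nonneg) auto
  also have "\<dots> = sobolev_weight d \<gamma> m * (\<Sum>(l, k)\<in>?I. (sphere_integral (\<lambda>x. f x * P l k x))\<^sup>2)"
  proof -
    have "(\<Sum>k=1..Z l. \<bar>fourier_coeff Y f l k\<bar>\<^sup>2) =
        (\<Sum>k=1..Z l. (sphere_integral (\<lambda>x. f x * P l k x))\<^sup>2)" for l
      by (intro sum.cong refl) (simp only: fourier power2_abs)
    then show ?thesis
      by (simp only: sum_distrib_left[symmetric]) (simp add: sum.Sigma)
  qed
  also have "\<dots> \<le> sobolev_weight d \<gamma> m * sphere_integral (\<lambda>x. (f x)\<^sup>2)"
  proof (rule mult_left_mono)
    show "(\<Sum>(l, k)\<in>?I. (sphere_integral (\<lambda>x. f x * P l k x))\<^sup>2) \<le> sphere_integral (\<lambda>x. (f x)\<^sup>2)"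
      using sphere_bessel_inequality[of ?I f "\<lambda>(l, k). P l k"] fc orth homogeneous_continuous[OF hP]
      by (auto simp: case_prod_beta split_beta')
    show "0 \<le> sobolev_weight d \<gamma> m" using sobolev_weight_pos[OF assms(2)] by (simp add: less_imp_le)
  qed
  finally show "sobolev_norm d \<gamma> Z Y f \<le> sqrt (sobolev_weight d \<gamma> m * sphere_integral (\<lambda>x. (f x)\<^sup>2))"
    by (simp add: sobolev_norm_def)
qed

lemma wce_ge_sobolev_weight:
  fixes x :: "nat \<Rightarrow> 'a::euclidean_space"
  assumes basis: "spherical_harmonic_basis Z Y" and d: "d \<ge> 1" "\<gamma> > 0" and dim: "DIM('a) = d + 1"
    and k: "2 * N \<le> (k + 1) ^ d"
  shows "wce (cubature N x \<omega>) (sobolev_space d \<gamma> Z Y) (sobolev_norm d \<gamma> Z Y)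
    \<ge> ereal (1 / (2 * sqrt (sobolev_weight d \<gamma> (2 * (k * d)))))"
proof -
  let ?m = "2 * (k * d)"
  let ?w = "sobolev_weight d \<gamma> ?m"
  have dim': "DIM('a) - 1 = d" using dim by simp
  obtain f and D :: nat where f: "homogeneous ?m f" "\<forall>i\<in>{1..N}. f (x i) = 0"
    "\<forall>y\<in>sphere 0 1. \<bar>f y\<bar> \<le> real D" "D > 0" "real D / 2 \<le> sphere_integral f"
    using fooling_function[of N k x, unfolded dim', OF k] by blast
  have w: "?w > 0" by (rule sobolev_weight_pos[OF d(1)])
  \<comment> \<open>The largest scaling for which the bound \<open>\<bar>f y\<bar> \<le> D\<close>
    still guarantees norm at most 1.\<close>
  define s where "s = 1 / (sqrt ?w * real D)"
  have s: "s > 0" using w f(4) by (simp add: s_def)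
  let ?g = "\<lambda>y. s * f y"
  have g: "homogeneous ?m ?g"
    using f(1) by (auto simp: homogeneous_def intro: real_polynomial_function.intros)
  have "sphere_integral (\<lambda>y. (f y)\<^sup>2) \<le> sphere_integral (\<lambda>y::'a. (real D)\<^sup>2)"
    by (intro sphere_integral_mono continuous_intros homogeneous_continuous[OF f(1)])
       (metis f(3) abs_le_square_iff abs_of_nat)
  then have "sphere_integral (\<lambda>y. (?g y)\<^sup>2) \<le> s\<^sup>2 * (real D)\<^sup>2"
    using s by (simp add: power_mult_distrib sphere_integral_cmult)
  also have "\<dots> = 1 / ?w"
    using w f(4) by (simp add: s_def power_divide power_mult_distrib)
  finally have "?w * sphere_integral (\<lambda>y. (?g y)\<^sup>2) \<le> 1"
    using w by (simp add: field_simps)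
  then have "sqrt (?w * sphere_integral (\<lambda>y. (?g y)\<^sup>2)) \<le> 1" by simp
  moreover have "sobolev_norm d \<gamma> Z Y ?g \<le> sqrt (?w * sphere_integral (\<lambda>y. (?g y)\<^sup>2))"
    using homogeneous_sobolev(2)[OF basis d _ g] dim d(1) by simp
  ultimately have norm: "sobolev_norm d \<gamma> Z Y ?g \<le> 1" by linarith
  have space: "?g \<in> sobolev_space d \<gamma> Z Y"
    using homogeneous_sobolev(1)[OF basis d _ g] dim d(1) by simp
  have "1 / (2 * sqrt ?w) = s * (real D / 2)"
    using f(4) by (simp add: s_def)
  also have "\<dots> \<le> s * sphere_integral f"
    using f(5) s by (intro mult_left_mono) auto
  also have "\<dots> = sphere_integral ?g" by (simp add: sphere_integral_cmult)
  \<comment> \<open>The cubature value is 0 for every choice of weights, so the error is the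
    integral itself.\<close>
  also have "\<dots> \<le> \<bar>cubature N x \<omega> ?g - sphere_integral ?g\<bar>"
    using f(2) by (simp add: cubature_def)
  finally have "ereal (1 / (2 * sqrt ?w)) \<le> ereal \<bar>cubature N x \<omega> ?g - sphere_integral ?g\<bar>" by simp
  also have "\<dots> \<le> wce (cubature N x \<omega>) (sobolev_space d \<gamma> Z Y) (sobolev_norm d \<gamma> Z Y)"
    unfolding wce_def using space norm homogeneous_continuous[OF g] by (intro SUP_upper) auto
  finally show ?thesis .
qed

text \<open>The first bound supplies enough forms, the second caps the weight. The least
  \<open>k\<close> has both: it is positive because \<open>1 ^ d < 2 * N\<close>, so its predecessor
  fails the first bound, and that failure is the second.\<close>

lemma least_grid_size:
  fixes N d :: nat
  assumes "N \<ge> 2" "d \<ge> 1"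
  obtains k where "2 * N \<le> (k + 1) ^ d" "k ^ d \<le> 2 * N" "1 \<le> k"
proof -
  let ?P = "\<lambda>k. 2 * N \<le> (k + 1) ^ d"
  define k where "k = (LEAST k. ?P k)"
  have "2 * N + 1 \<le> (2 * N + 1) ^ d" using assms(2) by (intro self_le_power) auto
  then have "?P (2 * N)" by simp
  then have k: "?P k" unfolding k_def by (rule LeastI)
  have k1: "1 \<le> k"
  proof (rule ccontr)
    assume "\<not> ?thesis"
    then have "k = 0" by simp
    with k assms(1) show False by simp
  qed
  then have "\<not> ?P (k - 1)" unfolding k_def by (intro not_less_Least) (simp add: k_def)
  with k1 have "k ^ d \<le> 2 * N" by simp
  with k k1 show ?thesis using that[of k] by blast
qed

text \<open>The eigenvalue at \<open>2 * k * d\<close> is at most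
  \<open>(2 * k * d) * (3 * k * d)\<close>, which gives the 6 in \<open>A\<close>; the summand 1
  absorbs the 1 of the weight because \<open>k \<ge> 1\<close>. Then
  \<open>k ^ d \<le> 2 * N\<close> trades the degree for \<open>N\<close>.\<close>

lemma sobolev_weight_le:
  fixes N d k :: nat
  defines "A \<equiv> 6 * (real d)\<^sup>2 + 1"
  defines "B \<equiv> ln (4 * (A + 2)) / ln 2 + 2"
  assumes "N \<ge> 2" "d \<ge> 1" "\<gamma> > 0" and k: "k ^ d \<le> 2 * N" "1 \<le> k"
  shows "sobolev_weight d \<gamma> (2 * (k * d)) \<le> A powr (real d / 2) * (2 * real N) * (B * ln (real N)) powr (2 * \<gamma>)"
proof -
  let ?e = "eigval d (2 * (k * d))"
  have A: "A \<ge> 1" by (simp add: A_def)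
  have e0: "?e \<ge> 0" by (rule eigval_nonneg[OF assms(4)])
  have "real d \<le> real k * real d"
    using mult_right_mono[of 1 "real k" "real d"] k(2) by simp
  then have "2 * (real k * real d) + real d - 1 \<le> 3 * (real k * real d)" by linarith
  then have "(2 * (real k * real d)) * (2 * (real k * real d) + real d - 1)
      \<le> (2 * (real k * real d)) * (3 * (real k * real d))"
    by (intro mult_left_mono) auto
  then have "?e \<le> (2 * (real k * real d)) * (3 * (real k * real d))"
    by (simp add: eigval_def)
  moreover have "1 \<le> (real k)\<^sup>2" using k(2) by simp
  ultimately have e: "1 + ?e \<le> A * (real k)\<^sup>2"
    by (simp add: A_def power2_eq_square algebra_simps)
  have kd: "real k ^ d \<le> 2 * real N"
    using k(1) by (metis of_nat_le_iff of_nat_mult of_nat_numeral of_nat_power)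
  have "(1 + ?e) powr (real d / 2) \<le> (A * (real k)\<^sup>2) powr (real d / 2)"
    using e e0 by (intro powr_mono2) auto
  also have "\<dots> = A powr (real d / 2) * real k ^ d"
  proof -
    have "(real k)\<^sup>2 powr (real d / 2) = real k ^ d"
      using k(2) by (simp add: powr_realpow[symmetric] powr_powr del: powr_numeral)
    then show ?thesis using A by (simp add: powr_mult)
  qed
  also have "\<dots> \<le> A powr (real d / 2) * (2 * real N)"
    using kd by (intro mult_left_mono) auto
  finally have 1: "(1 + ?e) powr (real d / 2) \<le> A powr (real d / 2) * (2 * real N)" .
  have "real k \<le> real k ^ d" using k(2) assms(4) by (intro self_le_power) auto
  then have "real k \<le> 2 * real N" using kd by linarith
  then have k2: "(real k)\<^sup>2 \<le> (2 * real N)\<^sup>2" by (intro power_mono) auto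
  have "3 + ?e \<le> (A + 2) * (real k)\<^sup>2"
    using e \<open>1 \<le> (real k)\<^sup>2\<close> by (simp add: algebra_simps)
  also have "\<dots> \<le> (A + 2) * (2 * real N)\<^sup>2"
    using k2 A by (intro mult_left_mono) auto
  finally have "3 + ?e \<le> 4 * (A + 2) * (real N)\<^sup>2" by (simp add: power2_eq_square algebra_simps)
  then have "ln (3 + ?e) \<le> ln (4 * (A + 2) * (real N)\<^sup>2)"
    using e0 by simp
  also have "\<dots> = ln (4 * (A + 2)) + 2 * ln (real N)"
    using A assms(3) by (simp add: ln_mult ln_realpow)
  \<comment> \<open>Since \<open>N \<ge> 2\<close>, a constant is at most itself divided by
    \<open>ln 2\<close> times \<open>ln N\<close>; this is the first summand of
    \<open>B\<close>.\<close>
  also have "\<dots> \<le> B * ln (real N)"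
  proof -
    have "ln (4 * (A + 2)) * ln 2 \<le> ln (4 * (A + 2)) * ln (real N)"
      using A assms(3) by (intro mult_left_mono) auto
    then show ?thesis by (simp add: B_def field_simps)
  qed
  finally have 2: "ln (3 + ?e) powr (2 * \<gamma>) \<le> (B * ln (real N)) powr (2 * \<gamma>)"
    using assms(5) e0 by (intro powr_mono2) auto
  show ?thesis
    unfolding sobolev_weight_def using 1 2 by (intro mult_mono) auto
qed

theorem theorem4:
  fixes d :: nat and \<gamma> :: real
  assumes "d \<ge> 2" and "CARD('n::finite) = d + 1" and "\<gamma> > 1 / 2"
  shows "\<exists>C>0. \<forall>Z (Y :: nat \<Rightarrow> nat \<Rightarrow> real ^ 'n \<Rightarrow> real). spherical_harmonic_basis Z Y \<longrightarrow>
    (\<forall>N\<ge>2. \<forall>(x :: nat \<Rightarrow> real ^ 'n) \<omega>.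
       (\<forall>i\<in>{1..N}. x i \<in> sphere 0 1) \<longrightarrow> (\<Sum>i=1..N. \<omega> i) = 1 \<longrightarrow>
       wce (cubature N x \<omega>) (sobolev_space d \<gamma> Z Y) (sobolev_norm d \<gamma> Z Y)
         \<ge> ereal (C * real N powr (- 1 / 2) * ln (real N) powr (- \<gamma>)))"
proof -
  define A where "A = 6 * (real d)\<^sup>2 + 1"
  define B where "B = ln (4 * (A + 2)) / ln 2 + 2"
  \<comment> \<open>The reciprocal of the part of \<open>2 * ?T\<close> free of \<open>N\<close>,
    where \<open>?T\<close> bounds the square root of the weight. It involves \<open>d\<close> and
    \<open>\<gamma>\<close> alone, as \<open>k\<close> has been eliminated.\<close>
  define C where "C = 1 / (2 * (sqrt (2 * A powr (real d / 2)) * B powr \<gamma>))"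
  have A: "A \<ge> 1" by (simp add: A_def)
  then have B: "B > 0" by (auto simp: B_def intro!: add_nonneg_pos divide_nonneg_pos)
  have C: "C > 0" using A B by (simp add: C_def)
  have bound: "wce (cubature N x \<omega>) (sobolev_space d \<gamma> Z Y) (sobolev_norm d \<gamma> Z Y)
      \<ge> ereal (C * real N powr (- 1 / 2) * ln (real N) powr (- \<gamma>))"
    if basis: "spherical_harmonic_basis Z Y" and N: "N \<ge> 2"
    for Z and Y :: "nat \<Rightarrow> nat \<Rightarrow> real ^ 'n \<Rightarrow> real" and N x \<omega>
  proof -
    obtain k where k: "2 * N \<le> (k + 1) ^ d" "k ^ d \<le> 2 * N" "1 \<le> k"
      by (rule least_grid_size[of N d]) (use N assms(1) in auto)
    let ?w = "sobolev_weight d \<gamma> (2 * (k * d))"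
    let ?T = "sqrt (2 * A powr (real d / 2)) * B powr \<gamma> * real N powr (1 / 2) * ln (real N) powr \<gamma>"
    have lnN: "ln (real N) > 0" using N by simp
    have "?w \<le> A powr (real d / 2) * (2 * real N) * (B * ln (real N)) powr (2 * \<gamma>)"
      unfolding A_def B_def by (rule sobolev_weight_le) (use N assms k in auto)
    also have "\<dots> = ?T\<^sup>2"
    proof -
      have "(B * ln (real N)) powr (2 * \<gamma>) = (B powr \<gamma>)\<^sup>2 * (ln (real N) powr \<gamma>)\<^sup>2"
        using B lnN by (simp add: powr_mult power2_eq_square powr_add[symmetric])
      moreover have "(real N powr (1 / 2))\<^sup>2 = real N"
        using N by (simp add: powr_half_sqrt)
      ultimately show ?thesis by (simp add: power_mult_distrib)
    qed
    finally have "sqrt ?w \<le> ?T"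
      by (rule real_le_lsqrt[rotated -1]) (simp_all add: A)
    moreover have "sqrt ?w > 0"
      using sobolev_weight_pos[of d] assms(1) by simp
    ultimately have "1 / (2 * ?T) \<le> 1 / (2 * sqrt ?w)"
      by (intro frac_le) linarith+
    also have "1 / (2 * ?T) = C * real N powr (- 1 / 2) * ln (real N) powr (- \<gamma>)"
      by (simp add: C_def powr_minus field_simps)
    finally have "ereal (C * real N powr (- 1 / 2) * ln (real N) powr (- \<gamma>)) \<le> ereal (1 / (2 * sqrt ?w))"
      by simp
    also have "\<dots> \<le> wce (cubature N x \<omega>) (sobolev_space d \<gamma> Z Y) (sobolev_norm d \<gamma> Z Y)"
      by (rule wce_ge_sobolev_weight[OF basis]) (use assms k in auto)
    finally show ?thesis .
  qed
  show ?thesis using C bound by (intro exI[of _ C]) blast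
qed

end
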